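(* Let $X=\ell^p=\ell^p(\mathbb N)$ with $p\in[1,\infty)$, let $\mu=\otimes_{k\in\mathbb N}\mathcal N(0,\sigma_k^2)$ be a non-degenerate ($\sigma_k>0$ for all $k$) centred diagonal Gaussian probability measure on $X$ with Cameron--Martin space $(E,|\cdot|_E)$, let $\Phi\colon X\to\mathbb R$ be an admissible potential, and let $\mu^y$ be the corresponding posterior probability measure. Let $I\colon E\to\mathbb R$, $I(u)=\Phi(u)+\tfrac12|u|_E^2$, be the Onsager--Machlup functional. Then: (a) For every $\bar z\in X$ the following statements are equivalent: (i) $\bar z$ is an $X$-strong limit point, as $\delta\to0$, of some asymptotic maximizing family for $\mu^y$; (ii) $\bar z\in E$ and $\bar z$ minimizes the Onsager--Machlup functional $I$ over $E$; (iii) $\bar z$ is a MAP estimator for $\mu^y$. (b) There exists at least one MAP estimator for $\mu^y$.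
   Context: $B_\delta(x)$ denotes the open ball of radius $\delta$ centred at $x$ in $(X,\|\cdot\|_X)$, $\|\cdot\|_X=\|\cdot\|_p$. That the product measure $\mu$ is a measure on $\ell^p$ means that it is concentrated on $\ell^p\subset\mathbb R^{\mathbb N}$. A function $\Phi\colon X\to\mathbb R$ is called an admissible potential if: (1) there is $M\in\mathbb R$ with $\Phi(u)\ge M$ for all $u\in X$; (2) for every $r>0$ there is $K(r)>0$ with $\Phi(u)\le K(r)$ for all $\|u\|_X<r$; (3) for every $r>0$ there is $L(r)>0$ with $|\Phi(u_1)-\Phi(u_2)|\le L(r)\|u_1-u_2\|_X$ whenever $\|u_1\|_X,\|u_2\|_X\le r$; and (normalization) $\Phi(0)=0$. The posterior $\mu^y$ is the probability measure on $X$ given by $\frac{d\mu^y}{d\mu}(u)=Z^{-1}\exp(-\Phi(u))$ with $Z=\int_X\exp(-\Phi(u))\,\mu(du)$. A MAP estimator for $\mu^y$ is a point $z\in X$ with $\lim_{\delta\searrow0}\frac{\mu^y(B_\delta(z))}{\sup_{x\in X}\mu^y(B_\delta(x))}=1$. A family $(\zeta^\delta)_{\delta>0}\subset X$ is an asymptotic maximizing family for $\mu^y$ if there is a family $(\varepsilon^\delta)_{\delta>0}$ in $(0,1)$ with $\varepsilon^\delta\to0$ as $\delta\searrow0$ such that $\frac{\mu^y(B_\delta(\zeta^\delta))}{\sup_{x\in X}\mu^y(B_\delta(x))}>1-\varepsilon^\delta$ for every $\delta>0$. $\bar z$ is an $X$-strong limit point of $(\zeta^\delta)_{\delta>0}$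 as $\delta\to0$ if there is a sequence $\delta_n\searrow0$ with $\|\zeta^{\delta_n}-\bar z\|_X\to0$. *)

theory Defs
  imports "HOL-Probability.Probability"
begin

text \<open>
  Since \<open>p\<close> is a parameter, \<open>\<ell>\<^sup>p\<close> is a carrier set of real sequences with an explicit norm,
  and maps on \<open>\<ell>\<^sup>p\<close> are total functions of which only the values on the carrier are used.
\<close>

definition lp :: "real \<Rightarrow> (nat \<Rightarrow> real) set" where
  "lp p = {x. summable (\<lambda>k. \<bar>x k\<bar> powr p)}"

definition lp_norm :: "real \<Rightarrow> (nat \<Rightarrow> real) \<Rightarrow> real" where
  "lp_norm p x = (\<Sum>k. \<bar>x k\<bar> powr p) powr (1 / p)"

definition lp_ball :: "real \<Rightarrow> real \<Rightarrow> (nat \<Rightarrow> real) \<Rightarrow> (nat \<Rightarrow> real) set" where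
  "lp_ball p \<delta> x = {u \<in> lp p. lp_norm p (\<lambda>k. u k - x k) < \<delta>}"

definition gauss_seq :: "(nat \<Rightarrow> real) \<Rightarrow> (nat \<Rightarrow> real) measure" where
  "gauss_seq \<sigma> = PiM UNIV (\<lambda>k. density lborel (\<lambda>x. ennreal (normal_density 0 (\<sigma> k) x)))"

text \<open>
  The Gaussian measure as a measure on \<open>\<ell>\<^sup>p\<close>. As \<open>\<ell>\<^sup>p\<close> is separable for \<open>1 \<le> p < \<infinity>\<close>, the trace on
  \<open>\<ell>\<^sup>p\<close> of the product sigma-algebra is the Borel sigma-algebra of the \<open>p\<close>-norm. The total mass is
  \<open>1\<close> exactly when \<open>gauss_seq \<sigma>\<close> is concentrated on \<open>\<ell>\<^sup>p\<close>, which is a hypothesis wherever this is used.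
\<close>

definition gauss_lp :: "real \<Rightarrow> (nat \<Rightarrow> real) \<Rightarrow> (nat \<Rightarrow> real) measure" where
  "gauss_lp p \<sigma> = restrict_space (gauss_seq \<sigma>) (lp p)"

definition lp_dual :: "real \<Rightarrow> ((nat \<Rightarrow> real) \<Rightarrow> real) set" where
  "lp_dual p = {l.
     (\<forall>x\<in>lp p. \<forall>y\<in>lp p. l (\<lambda>k. x k + y k) = l x + l y) \<and>
     (\<forall>c. \<forall>x\<in>lp p. l (\<lambda>k. c * x k) = c * l x) \<and>
     (\<exists>C. \<forall>x\<in>lp p. \<bar>l x\<bar> \<le> C * lp_norm p x)}"

text \<open>
  The Cameron--Martin space of a centred Gaussian measure \<open>M\<close> on \<open>\<ell>\<^sup>p\<close>, in the standard intrinsic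
  form: \<open>|h|\<^sub>E\<close> is the supremum of \<open>l h\<close> over continuous linear functionals \<open>l\<close> of variance at most
  \<open>1\<close> under \<open>M\<close>, and \<open>E\<close> consists of the \<open>h\<close> for which it is finite. The variance is a
  nonnegative Lebesgue integral, since a Bochner integral would be \<open>0\<close> if it failed to exist.
  \<open>cm_norm\<close> is meaningful only on \<open>cm_space\<close>.
\<close>

definition cm_functionals :: "real \<Rightarrow> (nat \<Rightarrow> real) measure \<Rightarrow> ((nat \<Rightarrow> real) \<Rightarrow> real) set" where
  "cm_functionals p M = {l \<in> lp_dual p. (\<integral>\<^sup>+ u. ennreal ((l u)\<^sup>2) \<partial>M) \<le> 1}"

definition cm_space :: "real \<Rightarrow> (nat \<Rightarrow> real) measure \<Rightarrow> (nat \<Rightarrow> real) set" where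
  "cm_space p M = {h \<in> lp p. bdd_above ((\<lambda>l. l h) ` cm_functionals p M)}"

definition cm_norm :: "real \<Rightarrow> (nat \<Rightarrow> real) measure \<Rightarrow> (nat \<Rightarrow> real) \<Rightarrow> real" where
  "cm_norm p M h = (SUP l\<in>cm_functionals p M. l h)"

definition admissible_potential :: "real \<Rightarrow> ((nat \<Rightarrow> real) \<Rightarrow> real) \<Rightarrow> bool" where
  "admissible_potential p \<Phi> \<longleftrightarrow>
     (\<exists>M. \<forall>u\<in>lp p. \<Phi> u \<ge> M) \<and>
     (\<forall>r>0. \<exists>K>0. \<forall>u\<in>lp p. lp_norm p u < r \<longrightarrow> \<Phi> u \<le> K) \<and>
     (\<forall>r>0. \<exists>L>0. \<forall>u\<in>lp p. \<forall>v\<in>lp p. lp_norm p u \<le> r \<longrightarrow> lp_norm p v \<le> r \<longrightarrow>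
        \<bar>\<Phi> u - \<Phi> v\<bar> \<le> L * lp_norm p (\<lambda>k. u k - v k)) \<and>
     \<Phi> (\<lambda>k. 0) = 0"

definition posterior :: "(nat \<Rightarrow> real) measure \<Rightarrow> ((nat \<Rightarrow> real) \<Rightarrow> real) \<Rightarrow> (nat \<Rightarrow> real) measure" where
  "posterior M \<Phi> = density M (\<lambda>u. ennreal (exp (- \<Phi> u) / (\<integral>v. exp (- \<Phi> v) \<partial>M)))"

definition onsager_machlup ::
    "real \<Rightarrow> (nat \<Rightarrow> real) measure \<Rightarrow> ((nat \<Rightarrow> real) \<Rightarrow> real) \<Rightarrow> (nat \<Rightarrow> real) \<Rightarrow> real" where
  "onsager_machlup p M \<Phi> u = \<Phi> u + 1 / 2 * (cm_norm p M u)\<^sup>2"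

definition ball_ratio :: "real \<Rightarrow> (nat \<Rightarrow> real) measure \<Rightarrow> real \<Rightarrow> (nat \<Rightarrow> real) \<Rightarrow> real" where
  "ball_ratio p P \<delta> z = measure P (lp_ball p \<delta> z) / (SUP x\<in>lp p. measure P (lp_ball p \<delta> x))"

definition MAP_estimator :: "real \<Rightarrow> (nat \<Rightarrow> real) measure \<Rightarrow> (nat \<Rightarrow> real) \<Rightarrow> bool" where
  "MAP_estimator p P z \<longleftrightarrow> z \<in> lp p \<and> ((\<lambda>\<delta>. ball_ratio p P \<delta> z) \<longlongrightarrow> 1) (at_right 0)"

definition asymptotic_maximizing_family ::
    "real \<Rightarrow> (nat \<Rightarrow> real) measure \<Rightarrow> (real \<Rightarrow> nat \<Rightarrow> real) \<Rightarrow> bool" where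
  "asymptotic_maximizing_family p P \<zeta> \<longleftrightarrow>
     (\<forall>\<delta>>0. \<zeta> \<delta> \<in> lp p) \<and>
     (\<exists>\<epsilon> :: real \<Rightarrow> real. (\<forall>\<delta>>0. 0 < \<epsilon> \<delta> \<and> \<epsilon> \<delta> < 1) \<and> (\<epsilon> \<longlongrightarrow> 0) (at_right 0) \<and>
        (\<forall>\<delta>>0. ball_ratio p P \<delta> (\<zeta> \<delta>) > 1 - \<epsilon> \<delta>))"

definition strong_limit_point ::
    "real \<Rightarrow> (real \<Rightarrow> nat \<Rightarrow> real) \<Rightarrow> (nat \<Rightarrow> real) \<Rightarrow> bool" where
  "strong_limit_point p \<zeta> z \<longleftrightarrow> z \<in> lp p \<and>
     (\<exists>d :: nat \<Rightarrow> real. (\<forall>n. d n > 0) \<and> decseq d \<and> d \<longlonglongrightarrow> 0 \<and>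
        (\<lambda>n. lp_norm p (\<lambda>k. \<zeta> (d n) k - z k)) \<longlonglongrightarrow> 0)"

end

theory Submission
  imports Defs
begin

text \<open>
  Write \<open>Q h = (\<Sum>k. (h k / \<sigma> k)\<^sup>2)\<close> and let \<open>B\<close> denote balls in \<open>\<ell>\<^sup>p\<close>. The decisive estimate is an
  explicit Anderson inequality: every \<open>x\<close> lies within \<open>2 \<delta>\<close> of some \<open>h\<close> with
  \<open>\<mu> (B \<delta> x) \<le> exp (- Q h / 2) * \<mu> (B \<delta> 0)\<close>; here \<open>h\<close> minimises \<open>Q\<close> on a finite-dimensional section
  of the ball. In the other direction \<open>\<mu> (B \<delta> h) \<ge> exp (- Q h / 2) * \<mu> (B \<delta> 0)\<close> for every \<open>h\<close> of
  finite energy. This lower bound also makes the sets \<open>Q \<le> C\<close> compact in \<open>\<ell>\<^sup>p\<close>, because balls of mass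
  bounded below have to meet a set of uniformly small tails. Consequently near-maximisers of
  \<open>\<mu>\<^sup>y (B \<delta> x)\<close> with \<open>\<delta> \<rightarrow> 0\<close> accumulate strongly, and every limit point \<open>z\<close> satisfies \<open>I z \<le> I h\<close>
  for all \<open>h \<in> E\<close>.
\<close>

section \<open>Sequence spaces\<close>

text \<open>The obstacle is uniformity. Near-maximisers move with \<delta>, may have infinite energy
  and are not known to be bounded, while \<Phi> is Lipschitz only on bounded sets. The upper bound
  therefore names a nearby point \<open>h\<close> of finite energy, and compactness is applied to
  these points. The bounds on \<Phi> enter in turn: the global lower bound gives a crude energy
  bound for the \<open>h\<close>; once a subsequence converges, the centres are bounded and the
  Lipschitz bound yields the sharp exponent.

  Since \<open>p = 1\<close> is allowed, neither reflexivity nor a differentiable norm is at hand.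
  The arguments use convexity of the ball, Tychonoff's theorem and the measure itself. Both mass
  estimates refer to the centred ball of the same radius, so its unknown decay cancels and only its
  positivity matters.

  \<open>Q\<close> occurs only through its partial sums. The Cameron-Martin space, defined by
  continuous functionals, is identified with the sequences of bounded partial energies by testing
  with finitely many coordinates.\<close>

lemma abs_powr_convex:
  fixes p s t x y :: real
  assumes "1 \<le> p" "0 \<le> s" "0 \<le> t" "s + t = 1"
  shows "\<bar>s * x + t * y\<bar> powr p \<le> s * \<bar>x\<bar> powr p + t * \<bar>y\<bar> powr p"
proof -
  have shrink: "r powr p \<le> r" if "0 \<le> r" "r \<le> 1" for r :: real
    using powr_mono'[of 1 p r] that assms(1) by (cases "r = 0") auto
  have le: "\<bar>s * x + t * y\<bar> powr p \<le> (s * \<bar>x\<bar> + t * \<bar>y\<bar>) powr p"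
    using assms abs_triangle_ineq[of "s * x" "t * y"] by (intro powr_mono2) (auto simp: abs_mult)
  consider "x = 0" | "y = 0" | "x \<noteq> 0" "y \<noteq> 0" by blast
  then show ?thesis
  proof cases
    case 1
    with shrink[of t] assms show ?thesis by (simp add: abs_mult powr_mult mult_right_mono)
  next
    case 2
    with shrink[of s] assms show ?thesis by (simp add: abs_mult powr_mult mult_right_mono)
  next
    case 3
    have "(s * \<bar>x\<bar> + t * \<bar>y\<bar>) powr p \<le> s * \<bar>x\<bar> powr p + t * \<bar>y\<bar> powr p"
      using convex_onD[OF powr_convex[OF assms(1)], of t "\<bar>x\<bar>" "\<bar>y\<bar>"] assms 3
      by (simp add: eq_diff_eq[symmetric])
    with le show ?thesis by linarith
  qed
qed

definition trunc :: "nat \<Rightarrow> (nat \<Rightarrow> real) \<Rightarrow> nat \<Rightarrow> real" where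
  "trunc n x = (\<lambda>k. if k < n then x k else 0)"

lemma trunc_0 [simp]: "trunc 0 x = (\<lambda>k. 0)"
  by (simp add: trunc_def)

lemma trunc_tendsto: "(\<lambda>n. trunc n x k) \<longlonglongrightarrow> x k"
  by (rule tendsto_eventually)
    (use eventually_gt_at_top[of k] in eventually_elim, simp add: trunc_def)

section \<open>Norm, triangle inequality and dominated convergence in the sequence space\<close>

locale lp_space =
  fixes p :: real
  assumes one_le_p: "1 \<le> p"
begin

lemma p_pos: "0 < p" and p_nonzero [simp]: "p \<noteq> 0"
  using one_le_p by auto

lemma lp_powr_summable: "x \<in> lp p \<Longrightarrow> summable (\<lambda>k. \<bar>x k\<bar> powr p)"
  by (simp add: lp_def)

lemma suminf_powr_nonneg: "x \<in> lp p \<Longrightarrow> 0 \<le> (\<Sum>k. \<bar>x k\<bar> powr p)"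
  by (auto simp: lp_def intro!: suminf_nonneg)

lemma lp_norm_nonneg [simp]: "0 \<le> lp_norm p x"
  by (simp add: lp_norm_def)

lemma lp_norm_powr: "x \<in> lp p \<Longrightarrow> lp_norm p x powr p = (\<Sum>k. \<bar>x k\<bar> powr p)"
  using suminf_powr_nonneg[of x] by (simp add: lp_norm_def powr_powr)

lemma lp_norm_less_iff:
  assumes "x \<in> lp p" "0 \<le> a"
  shows "lp_norm p x < a \<longleftrightarrow> (\<Sum>k. \<bar>x k\<bar> powr p) < a powr p"
  using lp_norm_powr[OF assms(1)] powr_less_mono2[OF p_pos, of "lp_norm p x" a]
    powr_mono2[of p a "lp_norm p x"] p_pos assms(2) by (cases "lp_norm p x < a") auto

lemma lp_norm_le_iff:
  assumes "x \<in> lp p" "0 \<le> a"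
  shows "lp_norm p x \<le> a \<longleftrightarrow> (\<Sum>k. \<bar>x k\<bar> powr p) \<le> a powr p"
  using lp_norm_powr[OF assms(1)] powr_less_mono2[OF p_pos, of a "lp_norm p x"]
    powr_mono2[of p "lp_norm p x" a] p_pos assms(2) by (cases "lp_norm p x \<le> a") auto

lemma lp_finite_support: "(\<And>k. n \<le> k \<Longrightarrow> x k = 0) \<Longrightarrow> x \<in> lp p"
  unfolding lp_def mem_Collect_eq by (rule summable_finite[of "{..<n}"]) (auto simp: not_less)

lemma lp_norm_finite_support:
  assumes "\<And>k. n \<le> k \<Longrightarrow> x k = 0"
  shows "lp_norm p x = (\<Sum>k<n. \<bar>x k\<bar> powr p) powr (1 / p)"
proof -
  have "(\<Sum>k. \<bar>x k\<bar> powr p) = (\<Sum>k<n. \<bar>x k\<bar> powr p)"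
    using assms by (intro suminf_finite) (auto simp: not_less)
  then show ?thesis by (simp add: lp_norm_def)
qed

lemma lp_trunc [simp]: "trunc n x \<in> lp p"
  by (rule lp_finite_support[of n]) (simp add: trunc_def)

lemma lp_zero [simp]: "(\<lambda>k. 0) \<in> lp p"
  by (rule lp_finite_support) simp

lemma lp_norm_zero [simp]: "lp_norm p (\<lambda>k. 0) = 0"
  by (simp add: lp_norm_def)

lemma lp_scale: "x \<in> lp p \<Longrightarrow> (\<lambda>k. c * x k) \<in> lp p"
  by (simp add: lp_def abs_mult powr_mult summable_mult)

lemma lp_norm_minus: "lp_norm p (\<lambda>k. y k - x k) = lp_norm p (\<lambda>k. x k - y k)"
  by (simp add: lp_norm_def abs_minus_commute)

lemma lp_dominated: "x \<in> lp p \<Longrightarrow> (\<And>k. \<bar>y k\<bar> \<le> \<bar>x k\<bar>) \<Longrightarrow> y \<in> lp p"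
  unfolding lp_def mem_Collect_eq
  by (rule summable_comparison_test[where g = "\<lambda>k. \<bar>x k\<bar> powr p"]) (use p_pos in \<open>auto intro!: powr_mono2\<close>)

lemma lp_norm_mono:
  assumes "x \<in> lp p" "\<And>k. \<bar>y k\<bar> \<le> \<bar>x k\<bar>"
  shows "lp_norm p y \<le> lp_norm p x"
proof -
  have "y \<in> lp p" by (rule lp_dominated) (fact assms)+
  then show ?thesis
    using assms p_pos unfolding lp_norm_def
    by (intro powr_mono2 suminf_le suminf_powr_nonneg lp_powr_summable) auto
qed

lemma abs_le_lp_norm:
  assumes "x \<in> lp p"
  shows "\<bar>x k\<bar> \<le> lp_norm p x"
proof -
  have "lp_norm p (\<lambda>j. if j = k then x k else 0) \<le> lp_norm p x"
    by (rule lp_norm_mono[OF assms]) auto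
  moreover have "(\<Sum>j. \<bar>if j = k then x k else 0\<bar> powr p) = (\<Sum>j\<in>{k}. \<bar>if j = k then x k else 0\<bar> powr p)"
    by (rule suminf_finite) auto
  ultimately show ?thesis by (simp add: lp_norm_def powr_powr)
qed

text \<open>Minkowski's inequality by convexity: for positive \<open>a\<close>, \<open>b\<close> not
  below the two norms, \<open>x + y\<close> is \<open>a + b\<close> times a convex combination of
  \<open>x / a\<close> and \<open>y / b\<close>, and \<open>abs_powr_convex\<close> is summed over
  the coordinates. Strictly positive bounds avoid division by a zero norm; they are lowered to the
  norms at the end.\<close>

lemma
  assumes x: "x \<in> lp p" and y: "y \<in> lp p"
  shows lp_add: "(\<lambda>k. x k + y k) \<in> lp p"
    and lp_norm_add_le: "lp_norm p (\<lambda>k. x k + y k) \<le> lp_norm p x + lp_norm p y"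
proof -
  have *: "(\<lambda>k. x k + y k) \<in> lp p \<and> lp_norm p (\<lambda>k. x k + y k) \<le> a + b"
    if a: "lp_norm p x \<le> a" "0 < a" and b: "lp_norm p y \<le> b" "0 < b" for a b
  proof -
    have sx: "(\<Sum>k. \<bar>x k\<bar> powr p) \<le> a powr p" and sy: "(\<Sum>k. \<bar>y k\<bar> powr p) \<le> b powr p"
      using lp_norm_le_iff[OF x, of a] lp_norm_le_iff[OF y, of b] a b by auto
    define s where "s = a / (a + b)"
    define t where "t = b / (a + b)"
    define f where "f = (\<lambda>k. (a + b) powr p * (s * (\<bar>x k\<bar> powr p / a powr p) + t * (\<bar>y k\<bar> powr p / b powr p)))"
    have st: "0 \<le> s" "0 \<le> t" "s + t = 1"
      using a b by (auto simp: s_def t_def add_divide_distrib[symmetric])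
    have le: "\<bar>x k + y k\<bar> powr p \<le> f k" for k
    proof -
      have "(a + b) * s = a" "(a + b) * t = b"
        using a b by (auto simp: s_def t_def)
      then have "(a + b) * (s * (x k / a) + t * (y k / b)) = a * (x k / a) + b * (y k / b)"
        by (simp only: distrib_left mult.assoc[symmetric])
      then have "x k + y k = (a + b) * (s * (x k / a) + t * (y k / b))"
        using a b by simp
      then have "\<bar>x k + y k\<bar> powr p = (a + b) powr p * \<bar>s * (x k / a) + t * (y k / b)\<bar> powr p"
        using a b by (simp add: abs_mult powr_mult)
      also have "\<dots> \<le> (a + b) powr p * (s * \<bar>x k / a\<bar> powr p + t * \<bar>y k / b\<bar> powr p)"
        by (intro mult_left_mono abs_powr_convex one_le_p st) auto
      also have "\<dots> = f k"
        using a b by (simp add: f_def powr_divide abs_divide)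
      finally show ?thesis .
    qed
    have sf: "summable f"
      unfolding f_def using x y
      by (intro summable_mult summable_add summable_divide lp_powr_summable)
    have mem: "(\<lambda>k. x k + y k) \<in> lp p"
      unfolding lp_def using summable_comparison_test[OF _ sf, of "\<lambda>k. \<bar>x k + y k\<bar> powr p"] le by auto
    have "(\<Sum>k. \<bar>x k + y k\<bar> powr p) \<le> suminf f"
      by (intro suminf_le le sf lp_powr_summable mem)
    also have "suminf f = (a + b) powr p * (s * ((\<Sum>k. \<bar>x k\<bar> powr p) / a powr p) + t * ((\<Sum>k. \<bar>y k\<bar> powr p) / b powr p))"
      unfolding f_def using x y
      by (simp add: suminf_mult suminf_add[symmetric] suminf_divide summable_mult summable_divide lp_powr_summable summable_add del: times_divide_eq_right)
    also have "\<dots> \<le> (a + b) powr p * (s * 1 + t * 1)"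
      using sx sy st a b by (intro mult_left_mono add_mono) auto
    finally have "(\<Sum>k. \<bar>x k + y k\<bar> powr p) \<le> (a + b) powr p" using st by simp
    then show ?thesis using mem lp_norm_le_iff[OF mem, of "a + b"] a b by auto
  qed
  show "(\<lambda>k. x k + y k) \<in> lp p"
    using *[of "lp_norm p x + 1" "lp_norm p y + 1"] lp_norm_nonneg[of x] lp_norm_nonneg[of y] by linarith
  show "lp_norm p (\<lambda>k. x k + y k) \<le> lp_norm p x + lp_norm p y"
  proof (rule field_le_epsilon)
    fix e :: real assume "0 < e"
    then show "lp_norm p (\<lambda>k. x k + y k) \<le> lp_norm p x + lp_norm p y + e"
      using *[of "lp_norm p x + e/2" "lp_norm p y + e/2"] lp_norm_nonneg[of x] lp_norm_nonneg[of y] by linarith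
  qed
qed

lemma lp_diff: "x \<in> lp p \<Longrightarrow> y \<in> lp p \<Longrightarrow> (\<lambda>k. x k - y k) \<in> lp p"
  using lp_add[of x "\<lambda>k. -1 * y k"] lp_scale[of y "-1"] by simp

lemma lp_norm_triangle:
  assumes "x \<in> lp p" "y \<in> lp p" "z \<in> lp p"
  shows "lp_norm p (\<lambda>k. x k - z k) \<le> lp_norm p (\<lambda>k. x k - y k) + lp_norm p (\<lambda>k. y k - z k)"
  using lp_norm_add_le[of "\<lambda>k. x k - y k" "\<lambda>k. y k - z k"] assms by (simp add: lp_diff)

lemma lp_norm_triangle_sub:
  assumes "x \<in> lp p" "y \<in> lp p"
  shows "lp_norm p x \<le> lp_norm p (\<lambda>k. x k - y k) + lp_norm p y"
  using lp_norm_triangle[OF assms lp_zero] by simp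

lemma lp_ball_subset:
  assumes "x \<in> lp p" "y \<in> lp p" "r + lp_norm p (\<lambda>k. x k - y k) \<le> s"
  shows "lp_ball p r x \<subseteq> lp_ball p s y"
proof
  fix u assume "u \<in> lp_ball p r x"
  then have "u \<in> lp p" "lp_norm p (\<lambda>k. u k - x k) < r" by (auto simp: lp_ball_def)
  with lp_norm_triangle[OF \<open>u \<in> lp p\<close> assms(1,2)] assms(3) show "u \<in> lp_ball p s y"
    by (auto simp: lp_ball_def)
qed

text \<open>Tannery's theorem with the summable majorant \<open>\<bar>2 * b k\<bar> powr p\<close>.
  This is the tool that turns convergence of coordinates into convergence in norm.\<close>

lemma lp_norm_tendsto_dominated:
  assumes b: "b \<in> lp p" and bound: "\<And>n k. \<bar>h n k\<bar> \<le> \<bar>b k\<bar>" and lim: "\<And>k. (\<lambda>n. h n k) \<longlonglongrightarrow> z k"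
  shows "z \<in> lp p" and "(\<lambda>n. lp_norm p (\<lambda>k. h n k - z k)) \<longlonglongrightarrow> 0"
proof -
  have zb: "\<bar>z k\<bar> \<le> \<bar>b k\<bar>" for k
    by (rule LIMSEQ_le_const2[OF tendsto_rabs[OF lim]]) (use bound in auto)
  show z: "z \<in> lp p" by (rule lp_dominated[OF b zb])
  have B: "summable (\<lambda>k. \<bar>2 * b k\<bar> powr p)"
    using lp_scale[OF b, of 2] by (rule lp_powr_summable)
  have le: "\<bar>h n k - z k\<bar> powr p \<le> \<bar>2 * b k\<bar> powr p" for n k
    using bound[of n k] zb[of k] p_pos by (intro powr_mono2) auto
  have "(\<lambda>n. \<Sum>k. \<bar>h n k - z k\<bar> powr p) \<longlonglongrightarrow> (\<Sum>k. 0 :: real)"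
  proof (rule tannerys_theorem[THEN conjunct2, THEN conjunct2, OF _ _ B])
    have "(\<lambda>n. \<bar>h n k - z k\<bar>) \<longlonglongrightarrow> 0" for k
      using tendsto_rabs_zero[OF LIM_zero[OF lim[of k]]] .
    then show "(\<lambda>n. \<bar>h n k - z k\<bar> powr p) \<longlonglongrightarrow> 0" for k
      by (rule tendsto_zero_powrI[OF _ tendsto_const]) (use p_pos in auto)
    show "\<forall>\<^sub>F (k, n) in sequentially \<times>\<^sub>F sequentially. norm (\<bar>h n k - z k\<bar> powr p) \<le> \<bar>2 * b k\<bar> powr p"
      using le by (intro always_eventually) auto
  qed auto
  then have "(\<lambda>n. \<Sum>k. \<bar>h n k - z k\<bar> powr p) \<longlonglongrightarrow> 0" by simp
  moreover have "h n \<in> lp p" for n by (rule lp_dominated[OF b bound])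
  ultimately show "(\<lambda>n. lp_norm p (\<lambda>k. h n k - z k)) \<longlonglongrightarrow> 0"
    unfolding lp_norm_def
    by (intro tendsto_zero_powrI[OF _ tendsto_const])
      (use p_pos z in \<open>auto intro!: suminf_powr_nonneg lp_diff always_eventually\<close>)
qed

lemma lp_norm_trunc_tendsto:
  assumes "x \<in> lp p"
  shows "(\<lambda>n. lp_norm p (\<lambda>k. trunc n x k - x k)) \<longlonglongrightarrow> 0"
  by (rule lp_norm_tendsto_dominated(2)[OF assms _ trunc_tendsto]) (simp add: trunc_def)

end

section \<open>Shifts, reflections and Anderson's inequality on a coordinate\<close>

context lp_space
begin

text \<open>The \<open>p\<close>-th power of the norm with values in \<open>ennreal\<close>: it
  makes sense for every sequence, is measurable without a summability condition, and is finite
  exactly on \<open>lp p\<close>.\<close>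

definition powsum :: "(nat \<Rightarrow> real) \<Rightarrow> ennreal" where
  "powsum x = (\<Sum>k. ennreal (\<bar>x k\<bar> powr p))"

lemma powsum_eq: "x \<in> lp p \<Longrightarrow> powsum x = ennreal (\<Sum>k. \<bar>x k\<bar> powr p)"
  unfolding powsum_def by (rule suminf_ennreal2) (auto simp: lp_powr_summable)

lemma lp_iff_powsum: "x \<in> lp p \<longleftrightarrow> powsum x < \<top>"
proof
  assume "powsum x < \<top>"
  then show "x \<in> lp p"
    unfolding powsum_def lp_def
    using summable_iff_suminf_neq_top[of "\<lambda>k. \<bar>x k\<bar> powr p"] by auto
qed (simp add: powsum_eq)

text \<open>Finiteness of \<open>powsum\<close> already contains membership in \<open>lp p\<close>,
  so a ball is a sublevel set in the full product space. Measurability of balls and the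
  coordinatewise arguments rest on this form.\<close>

lemma lp_ball_eq_powsum:
  assumes x: "x \<in> lp p" and "0 \<le> \<delta>"
  shows "lp_ball p \<delta> x = {u. powsum (\<lambda>k. u k - x k) < ennreal (\<delta> powr p)}"
proof (intro set_eqI)
  fix u
  have "u \<in> lp p \<longleftrightarrow> (\<lambda>k. u k - x k) \<in> lp p"
    using lp_add[OF _ x, of "\<lambda>k. u k - x k"] lp_diff[OF _ x, of u] by auto
  moreover have "lp_norm p (\<lambda>k. u k - x k) < \<delta> \<longleftrightarrow> powsum (\<lambda>k. u k - x k) < ennreal (\<delta> powr p)"
    if "(\<lambda>k. u k - x k) \<in> lp p"
    using that assms(2) by (simp add: lp_norm_less_iff powsum_eq ennreal_less_iff suminf_powr_nonneg)
  moreover have "(\<lambda>k. u k - x k) \<in> lp p" if "powsum (\<lambda>k. u k - x k) < ennreal (\<delta> powr p)"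
    using that by (auto simp: lp_iff_powsum intro: less_trans)
  ultimately show "u \<in> lp_ball p \<delta> x \<longleftrightarrow> u \<in> {u. powsum (\<lambda>k. u k - x k) < ennreal (\<delta> powr p)}"
    by (auto simp: lp_ball_def)
qed

lemma powsum_mono: "(\<And>k. \<bar>x k\<bar> \<le> \<bar>y k\<bar>) \<Longrightarrow> powsum x \<le> powsum y"
  unfolding powsum_def using p_pos by (intro suminf_le ennreal_leI powr_mono2) auto

end

lemma normal_density_decreasing:
  "0 < s \<Longrightarrow> \<bar>x\<bar> \<le> \<bar>y\<bar> \<Longrightarrow> normal_density 0 s y \<le> normal_density 0 s x"
  by (auto simp: normal_density_def abs_le_square_iff intro!: divide_right_mono mult_left_mono)

text \<open>
  Anderson's inequality on the line: the reflection \<open>x \<mapsto> t - x\<close> exchanges the interval and its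
  centred translate, and moves the part outside the centred one to points of larger density.
\<close>

lemma normal_anderson:
  fixes P :: "real \<Rightarrow> bool"
  assumes s: "0 < s" and P: "\<And>a b. P b \<Longrightarrow> 0 \<le> a \<Longrightarrow> a \<le> b \<Longrightarrow> P a"
    and [measurable]: "Measurable.pred borel P"
  shows "(\<integral>\<^sup>+x. ennreal (normal_density 0 s x) * indicator {x. P \<bar>x - t\<bar>} x \<partial>lborel)
       \<le> (\<integral>\<^sup>+x. ennreal (normal_density 0 s x) * indicator {x. P \<bar>x\<bar>} x \<partial>lborel)"
proof -
  let ?g = "\<lambda>x. ennreal (normal_density 0 s x)"
  let ?A = "{x. P \<bar>x - t\<bar>}" and ?B = "{x. P \<bar>x\<bar>}"
  have double: "2 * (\<integral>\<^sup>+x. ?g x * indicator {x. P \<bar>x - r\<bar>} x \<partial>lborel) =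
      (\<integral>\<^sup>+x. ?g x * indicator {x. P \<bar>x - r\<bar>} x + ?g (t - x) * indicator {x. P \<bar>x - r\<bar>} (t - x) \<partial>lborel)" for r
  proof -
    have "(\<integral>\<^sup>+x. ?g x * indicator {x. P \<bar>x - r\<bar>} x \<partial>lborel)
        = (\<integral>\<^sup>+x. ?g (t - x) * indicator {x. P \<bar>x - r\<bar>} (t - x) \<partial>lborel)"
      by (subst nn_integral_real_affine[where c = "-1" and t = t]) auto
    then show ?thesis
      by (subst nn_integral_add) (auto simp: mult_2)
  qed
  have "?g x * indicator ?A x + ?g (t - x) * indicator ?A (t - x)
      \<le> ?g x * indicator ?B x + ?g (t - x) * indicator ?B (t - x)" for x
  proof -
    have swap: "x \<in> ?A \<longleftrightarrow> t - x \<in> ?B" "t - x \<in> ?A \<longleftrightarrow> x \<in> ?B"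
      by (auto simp: abs_minus_commute)
    have "?g y \<le> ?g z" if "P \<bar>z\<bar>" "\<not> P \<bar>y\<bar>" for y z
      using P[OF that(1), of "\<bar>y\<bar>"] that(2) s by (intro ennreal_leI normal_density_decreasing) linarith+
    then show ?thesis
      using swap by (auto simp: indicator_def add.commute)
  qed
  then have "2 * (\<integral>\<^sup>+x. ?g x * indicator ?A x \<partial>lborel) \<le> 2 * (\<integral>\<^sup>+x. ?g x * indicator {x. P \<bar>x - 0\<bar>} x \<partial>lborel)"
    unfolding double by (intro nn_integral_mono) simp
  then show ?thesis by (simp add: ennreal_mult_le_mult_iff)
qed

locale diagonal_gaussian = lp_space +
  fixes \<sigma> :: "nat \<Rightarrow> real"
  assumes sigma_pos: "0 < \<sigma> k"
    and concentrated: "AE u in gauss_seq \<sigma>. u \<in> lp p"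
begin

section \<open>The product measure, integration in one coordinate, Cameron-Martin shifts and sign
  flips\<close>

abbreviation \<nu> :: "(nat \<Rightarrow> real) measure" where
  "\<nu> \<equiv> gauss_seq \<sigma>"

abbreviation normal :: "nat \<Rightarrow> real measure" where
  "normal k \<equiv> density lborel (\<lambda>x. ennreal (normal_density 0 (\<sigma> k) x))"

lemma sigma_nonzero [simp]: "\<sigma> k \<noteq> 0"
  using sigma_pos[of k] by simp

lemma sets_gauss_seq [measurable_cong]: "sets \<nu> = sets (\<Pi>\<^sub>M k\<in>UNIV. borel)"
  unfolding gauss_seq_def by (intro sets_PiM_cong) auto

lemma space_gauss_seq [simp]: "space \<nu> = UNIV"
  by (simp add: gauss_seq_def space_PiM)

lemma prob_space_gauss_seq: "prob_space \<nu>"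
  unfolding gauss_seq_def by (intro prob_space_PiM prob_space_normal_density sigma_pos)

sublocale prob_space \<nu>
  by (rule prob_space_gauss_seq)

lemma coordinatewise_measurable [measurable (raw)]:
  "(\<And>k. (\<lambda>u. f u k) \<in> borel_measurable M) \<Longrightarrow> f \<in> measurable M \<nu>"
  unfolding measurable_cong_sets[OF refl sets_gauss_seq]
  by (rule measurable_PiM_single') auto

lemma powsum_measurable [measurable (raw)]:
  "(\<And>k. (\<lambda>u. f u k) \<in> borel_measurable M) \<Longrightarrow> (\<lambda>u. powsum (f u)) \<in> borel_measurable M"
  unfolding powsum_def by measurable

lemma lp_measurable [measurable]: "lp p \<in> sets \<nu>"
proof -
  have "{u \<in> space \<nu>. powsum u < \<top>} \<in> sets \<nu>" by measurable
  then show ?thesis by (simp add: lp_iff_powsum[symmetric])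
qed

lemma lp_ball_measurable [measurable]:
  assumes "x \<in> lp p"
  shows "lp_ball p \<delta> x \<in> sets \<nu>"
proof (cases "0 \<le> \<delta>")
  case True
  have "{u \<in> space \<nu>. powsum (\<lambda>k. u k - x k) < ennreal (\<delta> powr p)} \<in> sets \<nu>" by measurable
  with lp_ball_eq_powsum[OF assms True] show ?thesis by simp
next
  case False
  have "lp_ball p \<delta> x = {}"
  proof (intro equals0I)
    fix u assume "u \<in> lp_ball p \<delta> x"
    then have "lp_norm p (\<lambda>k. u k - x k) < \<delta>" by (simp add: lp_ball_def)
    with False lp_norm_nonneg[of "\<lambda>k. u k - x k"] show False by linarith
  qed
  then show ?thesis by simp
qed

text \<open>Fubini's theorem as resampling: \<open>u\<close> is drawn from the whole product, then
  coordinate \<open>k\<close> is overwritten by an independent normal value. The index set need not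
  be split, and \<open>u\<close> keeps its type.\<close>

lemma nn_integral_coordinate:
  assumes [measurable]: "f \<in> borel_measurable \<nu>"
  shows "(\<integral>\<^sup>+u. f u \<partial>\<nu>) = (\<integral>\<^sup>+u. \<integral>\<^sup>+x. ennreal (normal_density 0 (\<sigma> k) x) * f (u(k := x)) \<partial>lborel \<partial>\<nu>)"
proof -
  interpret Nk: prob_space "normal k" by (rule prob_space_normal_density[OF sigma_pos])
  interpret pair_prob_space "normal k" \<nu> ..
  have eq: "\<nu> = distr (normal k \<Otimes>\<^sub>M \<nu>) \<nu> (\<lambda>(x, u). u(k := x))"
    using distr_pair_PiM_eq_PiM[of UNIV normal k] prob_space_normal_density[OF sigma_pos]
    by (simp add: gauss_seq_def)
  have upd [measurable]: "(\<lambda>(x, u). u(k := x)) \<in> measurable (normal k \<Otimes>\<^sub>M \<nu>) \<nu>"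
    by (rule coordinatewise_measurable) (auto simp: fun_upd_def split_beta)
  have "(\<integral>\<^sup>+u. f u \<partial>\<nu>) = (\<integral>\<^sup>+u. f u \<partial>distr (normal k \<Otimes>\<^sub>M \<nu>) \<nu> (\<lambda>(x, u). u(k := x)))"
    using eq by simp
  also have "\<dots> = (\<integral>\<^sup>+z. f ((\<lambda>(x, u). u(k := x)) z) \<partial>(normal k \<Otimes>\<^sub>M \<nu>))"
    by (rule nn_integral_distr[OF upd]) simp
  also have "\<dots> = (\<integral>\<^sup>+u. \<integral>\<^sup>+x. f (u(k := x)) \<partial>normal k \<partial>\<nu>)"
    by (subst nn_integral_snd[symmetric]) auto
  also have "\<dots> = (\<integral>\<^sup>+u. \<integral>\<^sup>+x. ennreal (normal_density 0 (\<sigma> k) x) * f (u(k := x)) \<partial>lborel \<partial>\<nu>)"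
    by (intro nn_integral_cong nn_integral_density) auto
  finally show ?thesis .
qed

lemma coordinate_update_measurable [measurable]:
  "(\<lambda>x. u(k := x)) \<in> measurable borel \<nu>"
  by (rule coordinatewise_measurable) (auto simp: fun_upd_def)

lemma normal_density_shift:
  "normal_density 0 (\<sigma> k) x * exp (- (t\<^sup>2 / 2 + x * t) / (\<sigma> k)\<^sup>2) = normal_density 0 (\<sigma> k) (x + t)"
  by (simp add: normal_density_def exp_add[symmetric] power2_sum add_divide_distrib diff_divide_distrib)

lemma nn_integral_shift_coordinate:
  assumes [measurable]: "f \<in> borel_measurable \<nu>"
  shows "(\<integral>\<^sup>+u. f u \<partial>\<nu>) =
    (\<integral>\<^sup>+u. f (u(k := u k + t)) * ennreal (exp (- (t\<^sup>2 / 2 + u k * t) / (\<sigma> k)\<^sup>2)) \<partial>\<nu>)"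
proof -
  let ?g = "\<lambda>x. ennreal (normal_density 0 (\<sigma> k) x)"
  have upd [measurable]: "(\<lambda>u. u(k := u k + t)) \<in> measurable \<nu> \<nu>"
    by (rule coordinatewise_measurable) (auto simp: fun_upd_def)
  have "(\<integral>\<^sup>+x. ?g x * f (u(k := x)) \<partial>lborel) =
      (\<integral>\<^sup>+x. ?g x * (f (u(k := x + t)) * ennreal (exp (- (t\<^sup>2 / 2 + x * t) / (\<sigma> k)\<^sup>2))) \<partial>lborel)" for u
  proof -
    have "(\<integral>\<^sup>+x. ?g x * f (u(k := x)) \<partial>lborel) = (\<integral>\<^sup>+x. ?g (t + x) * f (u(k := t + x)) \<partial>lborel)"
      by (subst nn_integral_real_affine[where c = 1 and t = t]) auto
    then show ?thesis
      by (simp add: normal_density_shift[symmetric, of k _ t] ennreal_mult' normal_density_nonneg add.commute ac_simps)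
  qed
  then show ?thesis
    by (subst (1 2) nn_integral_coordinate[of _ k]) auto
qed

text \<open>The Cameron-Martin formula for a shift of finitely many coordinates. Shifting coordinate
  \<open>n\<close> leaves the earlier summands of the exponent unchanged, so the densities multiply
  in the induction.\<close>

lemma nn_integral_shift:
  assumes [measurable]: "f \<in> borel_measurable \<nu>"
  shows "(\<integral>\<^sup>+u. f u \<partial>\<nu>) =
    (\<integral>\<^sup>+u. f (\<lambda>k. u k + trunc n h k) * ennreal (exp (- (\<Sum>k<n. ((h k)\<^sup>2 / 2 + u k * h k) / (\<sigma> k)\<^sup>2))) \<partial>\<nu>)"
proof (induction n)
  case (Suc n)
  let ?F = "\<lambda>u. f (\<lambda>k. u k + trunc n h k) * ennreal (exp (- (\<Sum>k<n. ((h k)\<^sup>2 / 2 + u k * h k) / (\<sigma> k)\<^sup>2)))"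
  have tr: "(\<lambda>k. (u(n := u n + h n)) k + trunc n h k) = (\<lambda>k. u k + trunc (Suc n) h k)" for u
    by (auto simp: trunc_def fun_eq_iff less_Suc_eq)
  have "(\<integral>\<^sup>+u. f u \<partial>\<nu>) = (\<integral>\<^sup>+u. ?F (u(n := u n + h n)) * ennreal (exp (- ((h n)\<^sup>2 / 2 + u n * h n) / (\<sigma> n)\<^sup>2)) \<partial>\<nu>)"
    unfolding Suc by (rule nn_integral_shift_coordinate) measurable
  moreover have "(\<Sum>k<n. ((h k)\<^sup>2 / 2 + (u(n := u n + h n)) k * h k) / (\<sigma> k)\<^sup>2) =
      (\<Sum>k<n. ((h k)\<^sup>2 / 2 + u k * h k) / (\<sigma> k)\<^sup>2)" for u
    by (rule sum.cong) auto
  moreover have "ennreal (exp (- a)) * ennreal (exp (- b / c)) = ennreal (exp (- (a + b / c)))" for a b c :: real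
    by (simp add: ennreal_mult[symmetric] exp_add[symmetric])
  ultimately show ?case
    by (simp only: tr mult.assoc sum.lessThan_Suc)
qed simp

lemma normal_reflect:
  assumes "g \<in> borel_measurable borel"
  shows "(\<integral>\<^sup>+x. ennreal (normal_density 0 s x) * g x \<partial>lborel) =
    (\<integral>\<^sup>+x. ennreal (normal_density 0 s x) * g (- x) \<partial>lborel)"
  using assms by (subst nn_integral_real_affine[where c = "-1" and t = 0]) (auto simp: normal_density_def)

lemma nn_integral_flip_coordinate:
  assumes [measurable]: "f \<in> borel_measurable \<nu>"
  shows "(\<integral>\<^sup>+u. f u \<partial>\<nu>) = (\<integral>\<^sup>+u. f (u(k := - u k)) \<partial>\<nu>)"
proof -
  have upd [measurable]: "(\<lambda>u. u(k := - u k)) \<in> measurable \<nu> \<nu>"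
    by (rule coordinatewise_measurable) (auto simp: fun_upd_def)
  have "(\<integral>\<^sup>+x. ennreal (normal_density 0 (\<sigma> k) x) * f (u(k := x)) \<partial>lborel) =
      (\<integral>\<^sup>+x. ennreal (normal_density 0 (\<sigma> k) x) * f (u(k := - x)) \<partial>lborel)" for u
    by (rule normal_reflect) measurable
  then show ?thesis
    by (subst (1 2) nn_integral_coordinate[of _ k]) auto
qed

lemma nn_integral_flip:
  assumes [measurable]: "f \<in> borel_measurable \<nu>"
  shows "(\<integral>\<^sup>+u. f u \<partial>\<nu>) = (\<integral>\<^sup>+u. f (\<lambda>k. if k < n then - u k else u k) \<partial>\<nu>)"
proof (induction n)
  case (Suc n)
  let ?F = "\<lambda>u. f (\<lambda>k. if k < n then - u k else u k)"
  have fl: "(\<lambda>k. if k < n then - (u(n := - u n)) k else (u(n := - u n)) k) = (\<lambda>k. if k < Suc n then - u k else u k)" for u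
    by (auto simp: fun_eq_iff less_Suc_eq)
  have "(\<integral>\<^sup>+u. ?F u \<partial>\<nu>) = (\<integral>\<^sup>+u. ?F (u(n := - u n)) \<partial>\<nu>)"
    by (rule nn_integral_flip_coordinate) measurable
  then show ?case
    unfolding Suc fl .
qed simp

end

section \<open>Small balls and the Cameron--Martin energy\<close>

text \<open>Tychonoff's theorem in the product topology, the topology of the function type. It
  supplies both the energy minimiser in a ball and the coordinatewise convergent
  subsequences.\<close>

lemma compact_coordinate_box:
  fixes b :: "nat \<Rightarrow> real"
  shows "compact {h. \<forall>k. \<bar>h k\<bar> \<le> b k}"
proof -
  have "{h. \<forall>k. \<bar>h k\<bar> \<le> b k} = PiE UNIV (\<lambda>k. {- b k..b k})"
    by (auto simp: PiE_def Pi_def abs_le_iff minus_le_iff)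
  moreover have "compactin (product_topology (\<lambda>k::nat. euclidean :: real topology) UNIV) (PiE UNIV (\<lambda>k. {- b k..b k}))"
    by (auto simp: compactin_PiE)
  ultimately show ?thesis by (simp add: euclidean_product_topology)
qed

context diagonal_gaussian
begin

text \<open>Partial sums of the squared Cameron-Martin norm. Finite energy is expressed by one bound
  for all \<open>n\<close>, so infinite values never occur, and each finite sum is continuous in the
  coordinates.\<close>

definition energy :: "nat \<Rightarrow> (nat \<Rightarrow> real) \<Rightarrow> real" where
  "energy n x = (\<Sum>k<n. (x k)\<^sup>2 / (\<sigma> k)\<^sup>2)"

lemma energy_nonneg: "0 \<le> energy n x"
  unfolding energy_def by (intro sum_nonneg) auto

lemma energy_mono: "(\<And>k. \<bar>x k\<bar> \<le> \<bar>y k\<bar>) \<Longrightarrow> energy n x \<le> energy n y"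
  unfolding energy_def by (intro sum_mono divide_right_mono) (auto simp: abs_le_square_iff)

lemma energy_finite_support:
  assumes "\<And>k. m \<le> k \<Longrightarrow> x k = 0"
  shows "energy n x \<le> energy m x"
proof -
  have "energy n x \<le> (\<Sum>k\<in>{..<n} \<union> {..<m}. (x k)\<^sup>2 / (\<sigma> k)\<^sup>2)"
    unfolding energy_def by (intro sum_mono2) auto
  also have "\<dots> = energy m x"
    unfolding energy_def using assms by (intro sum.mono_neutral_right) auto
  finally show ?thesis .
qed

lemma energy_tendsto: "(\<And>k. ((\<lambda>i. h i k) \<longlongrightarrow> z k) F) \<Longrightarrow> ((\<lambda>i. energy n (h i)) \<longlongrightarrow> energy n z) F"
  unfolding energy_def by (intro tendsto_sum tendsto_divide tendsto_power tendsto_const) auto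

text \<open>Continuity from below along radii increasing to \<open>\<delta>\<close>. Estimates then
  have to be shown only for smaller radii \<open>r\<close>, and the gap \<open>\<delta> - r\<close>
  can absorb a truncation error.\<close>

lemma prob_lp_ball_le_limit:
  assumes x: "x \<in> lp p" and le: "\<And>r. 0 \<le> r \<Longrightarrow> r < \<delta> \<Longrightarrow> prob (lp_ball p r x) \<le> c" and "0 < \<delta>"
  shows "prob (lp_ball p \<delta> x) \<le> c"
proof -
  define r where "r = (\<lambda>n::nat. \<delta> * (1 - inverse (real (Suc n))))"
  have r: "0 \<le> r n" "r n < \<delta>" for n
    using \<open>0 < \<delta>\<close> by (auto simp: r_def field_simps)
  have lim: "r \<longlonglongrightarrow> \<delta>"
    unfolding r_def using tendsto_mult[OF tendsto_const[of \<delta>] tendsto_diff[OF tendsto_const[of 1] LIMSEQ_inverse_real_of_nat]] by simp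
  have mono: "r m \<le> r n" if "m \<le> n" for m n
    unfolding r_def using that \<open>0 < \<delta>\<close> by (intro mult_left_mono) (auto simp: field_simps)
  have "incseq (\<lambda>n. lp_ball p (r n) x)"
    unfolding incseq_def lp_ball_def using mono by (auto intro: less_le_trans)
  then have "(\<lambda>n. prob (lp_ball p (r n) x)) \<longlonglongrightarrow> prob (\<Union>n. lp_ball p (r n) x)"
    using x by (intro finite_Lim_measure_incseq) auto
  moreover have "(\<Union>n. lp_ball p (r n) x) = lp_ball p \<delta> x"
  proof safe
    fix u n assume "u \<in> lp_ball p (r n) x"
    then show "u \<in> lp_ball p \<delta> x" using r[of n] by (auto simp: lp_ball_def)
  next
    fix u assume u: "u \<in> lp_ball p \<delta> x"
    then have "\<forall>\<^sub>F n in sequentially. lp_norm p (\<lambda>k. u k - x k) < r n"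
      by (intro order_tendstoD(1)[OF lim]) (simp add: lp_ball_def)
    then obtain n where "lp_norm p (\<lambda>k. u k - x k) < r n"
      by (auto simp: eventually_sequentially)
    with u show "u \<in> (\<Union>n. lp_ball p (r n) x)" by (auto simp: lp_ball_def)
  qed
  ultimately show ?thesis
    using le r by (intro LIMSEQ_le_const2[of "\<lambda>n. prob (lp_ball p (r n) x)"]) auto
qed

lemma powsum_cong_abs: "(\<And>k. \<bar>x k\<bar> = \<bar>y k\<bar>) \<Longrightarrow> powsum x = powsum y"
  by (simp add: powsum_def)

text \<open>With the other coordinates frozen, membership in the set depends on coordinate
  \<open>j\<close> only through its distance from \<open>x j\<close> and persists when that distance
  shrinks. Hence \<open>normal_anderson\<close> applies under the integral.\<close>

lemma anderson_coordinate:
  "emeasure \<nu> {u. powsum (\<lambda>k. u k - x k) < R} \<le> emeasure \<nu> {u. powsum (\<lambda>k. u k - (x(j := 0)) k) < R}"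
proof -
  have [measurable]: "{u. powsum (\<lambda>k. u k - y k) < R} \<in> sets \<nu>" for y
  proof -
    have "{u \<in> space \<nu>. powsum (\<lambda>k. u k - y k) < R} \<in> sets \<nu>" by measurable
    then show ?thesis by simp
  qed
  define P where "P = (\<lambda>u s. powsum (\<lambda>k. if k = j then s else u k - x k) < R)"
  have P_antimono: "P u a" if "P u b" "0 \<le> a" "a \<le> b" for u a b
    using that(1) unfolding P_def
    by (rule le_less_trans[rotated]) (rule powsum_mono, use that in auto)
  have [measurable]: "Measurable.pred borel (P u)" for u
  proof -
    have "(\<lambda>s. powsum (\<lambda>k. if k = j then s else u k - x k)) \<in> borel_measurable borel"
      by (rule powsum_measurable) auto
    then show ?thesis unfolding P_def by measurable
  qed
  have upd: "powsum (\<lambda>k. (u(j := s)) k - (x(j := t)) k) < R \<longleftrightarrow> P u \<bar>s - t\<bar>" for u s t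
    unfolding P_def by (subst powsum_cong_abs[of _ "\<lambda>k. if k = j then \<bar>s - t\<bar> else u k - x k"]) auto
  have eq: "emeasure \<nu> {u. powsum (\<lambda>k. u k - (x(j := t)) k) < R} =
      (\<integral>\<^sup>+u. \<integral>\<^sup>+s. ennreal (normal_density 0 (\<sigma> j) s) * indicator {s. P u \<bar>s - t\<bar>} s \<partial>lborel \<partial>\<nu>)" for t
  proof -
    have "emeasure \<nu> {u. powsum (\<lambda>k. u k - (x(j := t)) k) < R} =
       (\<integral>\<^sup>+u. indicator {u. powsum (\<lambda>k. u k - (x(j := t)) k) < R} u \<partial>\<nu>)"
      by (rule nn_integral_indicator[symmetric]) measurable
    also have "\<dots> = (\<integral>\<^sup>+u. \<integral>\<^sup>+s. ennreal (normal_density 0 (\<sigma> j) s) *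
        indicator {u. powsum (\<lambda>k. u k - (x(j := t)) k) < R} (u(j := s)) \<partial>lborel \<partial>\<nu>)"
      by (rule nn_integral_coordinate) measurable
    finally show ?thesis
      by (simp only: indicator_def mem_Collect_eq upd)
  qed
  \<comment> \<open>Writing \<open>x\<close> as \<open>x(j := x j)\<close> lets the formula
    \<open>eq\<close> serve both centres, with \<open>t = x j\<close> and
    \<open>t = 0\<close>.\<close>
  have "emeasure \<nu> {u. powsum (\<lambda>k. u k - (x(j := x j)) k) < R} \<le> emeasure \<nu> {u. powsum (\<lambda>k. u k - (x(j := 0)) k) < R}"
    unfolding eq
  proof (rule nn_integral_mono)
    fix u
    show "(\<integral>\<^sup>+s. ennreal (normal_density 0 (\<sigma> j) s) * indicator {s. P u \<bar>s - x j\<bar>} s \<partial>lborel)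
        \<le> (\<integral>\<^sup>+s. ennreal (normal_density 0 (\<sigma> j) s) * indicator {s. P u \<bar>s - 0\<bar>} s \<partial>lborel)"
      unfolding diff_0_right by (rule normal_anderson[OF sigma_pos P_antimono]) auto
  qed
  then show ?thesis by simp
qed

text \<open>Erasing coordinates of the centre one by one never decreases the mass. What remains is
  the tail of \<open>x\<close>, eventually of norm below \<open>\<delta> - r\<close>, and the ball
  of radius \<open>r\<close> about it lies in the centred ball.\<close>

lemma prob_lp_ball_le_centred:
  assumes x: "x \<in> lp p" and \<delta>: "0 < \<delta>"
  shows "prob (lp_ball p \<delta> x) \<le> prob (lp_ball p \<delta> (\<lambda>k. 0))"
proof (rule prob_lp_ball_le_limit[OF x _ \<delta>])
  fix r assume r: "0 \<le> r" "r < \<delta>"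
  have tail: "prob (lp_ball p r x) \<le> prob (lp_ball p r (\<lambda>k. x k - trunc n x k))" for n
  proof (induction n)
    case (Suc n)
    have eq: "(\<lambda>k. x k - trunc n x k)(n := 0) = (\<lambda>k. x k - trunc (Suc n) x k)"
      by (auto simp: trunc_def fun_eq_iff less_Suc_eq)
    have "emeasure \<nu> (lp_ball p r (\<lambda>k. x k - trunc n x k)) \<le> emeasure \<nu> (lp_ball p r (\<lambda>k. x k - trunc (Suc n) x k))"
      using anderson_coordinate[of "\<lambda>k. x k - trunc n x k" "ennreal (r powr p)" n] x r
      unfolding eq by (simp add: lp_ball_eq_powsum lp_diff)
    then have "prob (lp_ball p r (\<lambda>k. x k - trunc n x k)) \<le> prob (lp_ball p r (\<lambda>k. x k - trunc (Suc n) x k))"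
      by (simp add: emeasure_eq_measure)
    with Suc show ?case by linarith
  qed simp
  have "\<forall>\<^sub>F n in sequentially. lp_norm p (\<lambda>k. trunc n x k - x k) < \<delta> - r"
    using r by (intro order_tendstoD(2)[OF lp_norm_trunc_tendsto[OF x]]) auto
  then obtain n where n: "lp_norm p (\<lambda>k. x k - trunc n x k) < \<delta> - r"
    by (auto simp: eventually_sequentially lp_norm_minus)
  have "lp_ball p r (\<lambda>k. x k - trunc n x k) \<subseteq> lp_ball p \<delta> (\<lambda>k. 0)"
    using n x by (intro lp_ball_subset) (auto simp: lp_diff)
  then have "prob (lp_ball p r (\<lambda>k. x k - trunc n x k)) \<le> prob (lp_ball p \<delta> (\<lambda>k. 0))"
    by (intro finite_measure_mono) auto
  with tail[of n] show "prob (lp_ball p r x) \<le> prob (lp_ball p \<delta> (\<lambda>k. 0))" by linarith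
qed

section \<open>The energy minimiser and the two bounds for small balls\<close>

lemma energy_line:
  "energy n (\<lambda>k. h k + s * (u k - h k)) =
    energy n h + 2 * s * (\<Sum>k<n. h k * (u k - h k) / (\<sigma> k)\<^sup>2) + s\<^sup>2 * (\<Sum>k<n. (u k - h k)\<^sup>2 / (\<sigma> k)\<^sup>2)"
  unfolding energy_def sum_distrib_left sum.distrib[symmetric]
  by (intro sum.cong refl) (simp add: power2_sum power_mult_distrib add_divide_distrib)

text \<open>\<open>h\<close> has least energy under the constraint, and the last clause is its
  variational inequality. Only convexity of the constraint and a parabola along a segment are used,
  so corners of the norm at \<open>p = 1\<close> do no harm.\<close>

lemma minimal_energy_point:
  assumes \<delta>: "0 < \<delta>"
  shows "\<exists>h. (\<forall>k\<ge>n. h k = 0) \<and> (\<Sum>k<n. \<bar>h k - x k\<bar> powr p) \<le> \<delta> powr p \<and>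
    (\<forall>u. (\<Sum>k<n. \<bar>u k - x k\<bar> powr p) \<le> \<delta> powr p \<longrightarrow> 0 \<le> (\<Sum>k<n. h k * (u k - h k) / (\<sigma> k)\<^sup>2))"
proof -
  define K where "K = {h. (\<forall>k. n \<le> k \<longrightarrow> h k = 0) \<and> (\<Sum>k<n. \<bar>h k - x k\<bar> powr p) \<le> \<delta> powr p}"
  have "K \<subseteq> {h. \<forall>k. \<bar>h k\<bar> \<le> \<bar>x k\<bar> + \<delta>}"
  proof safe
    fix h k assume h: "h \<in> K"
    show "\<bar>h k\<bar> \<le> \<bar>x k\<bar> + \<delta>"
    proof (cases "k < n")
      case True
      then have "\<bar>h k - x k\<bar> powr p \<le> (\<Sum>k<n. \<bar>h k - x k\<bar> powr p)"
        by (intro member_le_sum) auto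
      also have "\<dots> \<le> \<delta> powr p" using h by (simp add: K_def)
      finally have "\<bar>h k - x k\<bar> \<le> \<delta>"
        using powr_less_mono2[OF p_pos, of \<delta> "\<bar>h k - x k\<bar>"] \<delta> by linarith
      then show ?thesis by linarith
    next
      case False
      with h \<delta> show ?thesis by (simp add: K_def)
    qed
  qed
  moreover have "closed K"
    unfolding K_def
    by (intro closed_Collect_conj closed_Collect_all closed_Collect_imp closed_Collect_eq closed_Collect_le
        continuous_on_sum continuous_on_powr' continuous_intros) (use p_pos in auto)
  ultimately have "compact K"
    using compact_Int_closed[OF compact_coordinate_box[of "\<lambda>k. \<bar>x k\<bar> + \<delta>"] \<open>closed K\<close>]
    by (simp add: Int_absorb1)
  moreover have "trunc n x \<in> K"
    using \<delta> by (auto simp: K_def trunc_def)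
  moreover have "continuous_on K (energy n)"
    unfolding energy_def
    by (intro continuous_intros continuous_on_subset[OF continuous_on_product_coordinates]) auto
  ultimately obtain h where h: "h \<in> K" and min: "\<And>u. u \<in> K \<Longrightarrow> energy n h \<le> energy n u"
    using continuous_attains_inf[of K "energy n"] by blast
  show ?thesis
  proof (intro exI[of _ h] conjI allI impI)
    show "h k = 0" if "n \<le> k" for k using h that by (simp add: K_def)
    show hle: "(\<Sum>k<n. \<bar>h k - x k\<bar> powr p) \<le> \<delta> powr p" using h by (simp add: K_def)
    fix u assume u: "(\<Sum>k<n. \<bar>u k - x k\<bar> powr p) \<le> \<delta> powr p"
    define D where "D = (\<Sum>k<n. h k * (u k - h k) / (\<sigma> k)\<^sup>2)"
    define S where "S = (\<Sum>k<n. (u k - h k)\<^sup>2 / (\<sigma> k)\<^sup>2)"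
    have S: "0 \<le> S" unfolding S_def by (intro sum_nonneg) auto
    have var: "0 \<le> s * (2 * D + s * S)" if s: "0 < s" "s \<le> 1" for s
    proof -
      let ?v = "\<lambda>k. h k + s * (u k - h k)"
      have "(\<Sum>k<n. \<bar>?v k - x k\<bar> powr p) \<le> (\<Sum>k<n. (1 - s) * \<bar>h k - x k\<bar> powr p + s * \<bar>u k - x k\<bar> powr p)"
      proof (rule sum_mono)
        fix k
        have "?v k - x k = (1 - s) * (h k - x k) + s * (u k - x k)" by (simp add: algebra_simps)
        then show "\<bar>?v k - x k\<bar> powr p \<le> (1 - s) * \<bar>h k - x k\<bar> powr p + s * \<bar>u k - x k\<bar> powr p"
          using abs_powr_convex[OF one_le_p, of "1 - s" s] s by simp
      qed
      also have "\<dots> = (1 - s) * (\<Sum>k<n. \<bar>h k - x k\<bar> powr p) + s * (\<Sum>k<n. \<bar>u k - x k\<bar> powr p)"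
        by (simp add: sum.distrib sum_distrib_left)
      also have "\<dots> \<le> (1 - s) * \<delta> powr p + s * \<delta> powr p"
        using s hle u by (intro add_mono mult_left_mono) auto
      also have "\<dots> = \<delta> powr p" by (simp add: algebra_simps)
      \<comment> \<open>Only coordinates below \<open>n\<close> enter the constraint and the energy,
        so truncation puts the convex combination into \<open>K\<close> without changing
        either.\<close>
      finally have "trunc n ?v \<in> K" by (simp add: K_def trunc_def)
      then have "energy n h \<le> energy n (trunc n ?v)" by (rule min)
      also have "\<dots> = energy n ?v" by (simp add: energy_def trunc_def)
      finally have "0 \<le> 2 * s * D + s\<^sup>2 * S"
        by (simp only: energy_line D_def S_def)
      then show ?thesis by (simp add: power2_eq_square algebra_simps)
    qed
    show "0 \<le> (\<Sum>k<n. h k * (u k - h k) / (\<sigma> k)\<^sup>2)"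
    proof (rule ccontr)
      assume "\<not> ?thesis"
      then have D: "D < 0" by (simp add: D_def)
      \<comment> \<open>This step length gives \<open>s * S \<le> - D\<close>, hence
        \<open>2 * D + s * S \<le> D < 0\<close>, against \<open>var\<close>. The summand 1 in the
        denominator covers \<open>S = 0\<close>.\<close>
      define s where "s = min 1 (- D / (S + 1))"
      have s: "0 < s" "s \<le> 1" using D S by (auto simp: s_def divide_neg_pos)
      have "s * S \<le> - D / (S + 1) * S" unfolding s_def using S by (intro mult_right_mono) auto
      also have "\<dots> = - D * (S / (S + 1))" by simp
      also have "\<dots> \<le> - D * 1" using D S by (intro mult_left_mono) auto
      finally have "2 * D + s * S < 0" using D by linarith
      with var[OF s] s show False by (simp add: zero_le_mult_iff)
    qed
  qed
qed

lemma sum_powr_le_of_mem_lp_ball: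
  assumes "u \<in> lp_ball p \<delta> x" "x \<in> lp p" "0 < \<delta>"
  shows "(\<Sum>k<n. \<bar>u k - x k\<bar> powr p) \<le> \<delta> powr p"
proof -
  have mem: "(\<lambda>k. u k - x k) \<in> lp p" using assms by (auto simp: lp_ball_def lp_diff)
  have "(\<Sum>k<n. \<bar>u k - x k\<bar> powr p) \<le> (\<Sum>k. \<bar>u k - x k\<bar> powr p)"
    by (rule sum_le_suminf) (use mem in \<open>auto simp: lp_powr_summable\<close>)
  also have "\<dots> \<le> \<delta> powr p"
    using lp_norm_le_iff[OF mem, of \<delta>] assms by (auto simp: lp_ball_def)
  finally show ?thesis .
qed

text \<open>The density of the shift splits into a constant and the exponential of a linear
  functional. The upper estimate fixes the sign of that functional on the ball; the lower one
  removes it by symmetry.\<close>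

lemma emeasure_lp_ball_shift:
  assumes "x \<in> lp p" "\<And>k. n \<le> k \<Longrightarrow> h k = 0"
  shows "emeasure \<nu> (lp_ball p \<delta> x) = (\<integral>\<^sup>+u. indicator (lp_ball p \<delta> (\<lambda>k. x k - h k)) u *
    ennreal (exp (- energy n h / 2) * exp (- (\<Sum>k<n. u k * h k / (\<sigma> k)\<^sup>2))) \<partial>\<nu>)"
proof -
  have h: "h \<in> lp p" by (rule lp_finite_support) (rule assms)
  have tr: "trunc n h = h" using assms(2) by (auto simp: trunc_def fun_eq_iff)
  have mem: "(\<lambda>k. u k + h k) \<in> lp_ball p \<delta> x \<longleftrightarrow> u \<in> lp_ball p \<delta> (\<lambda>k. x k - h k)" for u
    using lp_add[OF _ h, of u] lp_diff[OF _ h, of "\<lambda>k. u k + h k"] by (auto simp: lp_ball_def algebra_simps)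
  have ex: "exp (- (\<Sum>k<n. ((h k)\<^sup>2 / 2 + u k * h k) / (\<sigma> k)\<^sup>2)) =
      exp (- energy n h / 2) * exp (- (\<Sum>k<n. u k * h k / (\<sigma> k)\<^sup>2))" for u
    by (simp add: energy_def exp_add[symmetric] add_divide_distrib sum.distrib sum_divide_distrib mult.commute)
  have "emeasure \<nu> (lp_ball p \<delta> x) = (\<integral>\<^sup>+u. indicator (lp_ball p \<delta> x) u \<partial>\<nu>)"
    using assms by (intro nn_integral_indicator[symmetric]) measurable
  also have "\<dots> = (\<integral>\<^sup>+u. indicator (lp_ball p \<delta> x) (\<lambda>k. u k + trunc n h k) *
      ennreal (exp (- (\<Sum>k<n. ((h k)\<^sup>2 / 2 + u k * h k) / (\<sigma> k)\<^sup>2))) \<partial>\<nu>)"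
    using assms by (intro nn_integral_shift) measurable
  finally show ?thesis unfolding tr by (simp only: ex indicator_def mem)
qed

text \<open>
  The explicit form of Anderson's inequality. The first variation of the energy at its minimiser
  \<open>h\<close> makes the Cameron--Martin density of the shift by \<open>h\<close> at most \<open>exp (- energy / 2)\<close> on the
  whole ball.
\<close>

lemma prob_lp_ball_le_energy:
  assumes x: "x \<in> lp p" and \<delta>: "0 < \<delta>"
  obtains h n where "h \<in> lp p" "\<And>m. energy m h \<le> energy n h" "lp_norm p (\<lambda>k. h k - x k) \<le> 2 * \<delta>"
    "prob (lp_ball p \<delta> x) \<le> exp (- energy n h / 2) * prob (lp_ball p \<delta> (\<lambda>k. 0))"
proof -
  have "\<forall>\<^sub>F n in sequentially. lp_norm p (\<lambda>k. trunc n x k - x k) < \<delta>"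
    using \<delta> by (intro order_tendstoD(2)[OF lp_norm_trunc_tendsto[OF x]]) auto
  then obtain n where n: "lp_norm p (\<lambda>k. trunc n x k - x k) < \<delta>"
    by (auto simp: eventually_sequentially)
  obtain h where h0: "\<And>k. n \<le> k \<Longrightarrow> h k = 0"
    and hx: "(\<Sum>k<n. \<bar>h k - x k\<bar> powr p) \<le> \<delta> powr p"
    and var: "\<And>u. (\<Sum>k<n. \<bar>u k - x k\<bar> powr p) \<le> \<delta> powr p \<Longrightarrow> 0 \<le> (\<Sum>k<n. h k * (u k - h k) / (\<sigma> k)\<^sup>2)"
    using minimal_energy_point[OF \<delta>, of n x] by blast
  have h: "h \<in> lp p" by (rule lp_finite_support) (rule h0)
  have "(\<Sum>k<n. \<bar>h k - trunc n x k\<bar> powr p) \<le> \<delta> powr p"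
    using hx by (simp add: trunc_def)
  then have "(\<Sum>k<n. \<bar>h k - trunc n x k\<bar> powr p) powr (1 / p) \<le> (\<delta> powr p) powr (1 / p)"
    using p_pos by (intro powr_mono2 sum_nonneg) auto
  then have "lp_norm p (\<lambda>k. h k - trunc n x k) \<le> \<delta>"
    using \<delta> h0 by (subst lp_norm_finite_support[of n]) (auto simp: trunc_def powr_powr)
  \<comment> \<open>One \<open>\<delta>\<close> comes from the constraint relative to
    \<open>trunc n x\<close>, the other from truncating \<open>x\<close>.\<close>
  with lp_norm_triangle[OF h lp_trunc x, of n x] n have near: "lp_norm p (\<lambda>k. h k - x k) \<le> 2 * \<delta>"
    by linarith
  have en: "energy m h \<le> energy n h" for m
    by (rule energy_finite_support) (rule h0)
  have "emeasure \<nu> (lp_ball p \<delta> x) = (\<integral>\<^sup>+u. indicator (lp_ball p \<delta> (\<lambda>k. x k - h k)) u *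
    ennreal (exp (- energy n h / 2) * exp (- (\<Sum>k<n. u k * h k / (\<sigma> k)\<^sup>2))) \<partial>\<nu>)"
    by (rule emeasure_lp_ball_shift[OF x]) (rule h0)
  also have "\<dots> \<le> (\<integral>\<^sup>+u. ennreal (exp (- energy n h / 2)) * indicator (lp_ball p \<delta> (\<lambda>k. x k - h k)) u \<partial>\<nu>)"
  proof (intro nn_integral_mono)
    fix u
    show "indicator (lp_ball p \<delta> (\<lambda>k. x k - h k)) u * ennreal (exp (- energy n h / 2) * exp (- (\<Sum>k<n. u k * h k / (\<sigma> k)\<^sup>2)))
      \<le> ennreal (exp (- energy n h / 2)) * indicator (lp_ball p \<delta> (\<lambda>k. x k - h k)) u"
    proof (cases "u \<in> lp_ball p \<delta> (\<lambda>k. x k - h k)")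
      case True
      then have "(\<lambda>k. u k + h k) \<in> lp_ball p \<delta> x"
        using lp_add[OF _ h, of u] by (auto simp: lp_ball_def algebra_simps)
      then have "0 \<le> (\<Sum>k<n. h k * ((u k + h k) - h k) / (\<sigma> k)\<^sup>2)"
        by (intro var sum_powr_le_of_mem_lp_ball x \<delta>)
      then have "exp (- (\<Sum>k<n. u k * h k / (\<sigma> k)\<^sup>2)) \<le> 1"
        by (simp add: mult.commute)
      with True show ?thesis by (auto intro!: ennreal_leI mult_left_le)
    qed simp
  qed
  also have "\<dots> = ennreal (exp (- energy n h / 2)) * emeasure \<nu> (lp_ball p \<delta> (\<lambda>k. x k - h k))"
    by (rule nn_integral_cmult_indicator) (use x h in \<open>auto simp: lp_diff\<close>)
  finally have "prob (lp_ball p \<delta> x) \<le> exp (- energy n h / 2) * prob (lp_ball p \<delta> (\<lambda>k. x k - h k))"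
    by (simp add: emeasure_eq_measure ennreal_mult[symmetric])
  \<comment> \<open>The translated ball is still centred at \<open>x - h\<close>; the plain Anderson
    inequality moves it to the origin at no cost.\<close>
  also have "\<dots> \<le> exp (- energy n h / 2) * prob (lp_ball p \<delta> (\<lambda>k. 0))"
    using x h \<delta> by (intro mult_left_mono prob_lp_ball_le_centred) (auto simp: lp_diff)
  finally show thesis
    by (rule that[OF h en near])
qed

text \<open>
  Averaging the shifted ball over the sign flip turns the Cameron--Martin density into a hyperbolic
  cosine, which is at least \<open>1\<close>.
\<close>

lemma prob_lp_ball_finite_support_ge:
  assumes h0: "\<And>k. n \<le> k \<Longrightarrow> h k = 0"
  shows "exp (- energy n h / 2) * prob (lp_ball p \<delta> (\<lambda>k. 0)) \<le> prob (lp_ball p \<delta> h)"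
proof -
  let ?B = "lp_ball p \<delta> (\<lambda>k. 0)" and ?c = "exp (- energy n h / 2)"
  let ?L = "\<lambda>u. \<Sum>k<n. u k * h k / (\<sigma> k)\<^sup>2"
  let ?f = "\<lambda>u. indicator ?B u * ennreal (?c * exp (- ?L u))"
  let ?flip = "\<lambda>u k. if k < n then - u k else u k"
  have h: "h \<in> lp p" by (rule lp_finite_support) (rule h0)
  have B [measurable]: "?B \<in> sets \<nu>" by (rule lp_ball_measurable) simp
  have [measurable]: "?flip \<in> measurable \<nu> \<nu>"
    by (rule coordinatewise_measurable) auto
  have flip_B: "?flip u \<in> ?B \<longleftrightarrow> u \<in> ?B" for u
  proof -
    have abs: "\<bar>?flip u k\<bar> = \<bar>u k\<bar>" for k by auto
    show ?thesis by (simp add: lp_ball_def lp_def lp_norm_def abs)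
  qed
  have flip_L: "?L (?flip u) = - ?L u" for u
    by (simp add: sum_negf)
  have f: "(\<integral>\<^sup>+u. ?f u \<partial>\<nu>) = emeasure \<nu> (lp_ball p \<delta> h)"
    using emeasure_lp_ball_shift[OF h h0, where \<delta> = \<delta>] by simp
  have "2 * (ennreal ?c * emeasure \<nu> ?B) = (\<integral>\<^sup>+u. 2 * (ennreal ?c * indicator ?B u) \<partial>\<nu>)"
    by (simp add: nn_integral_cmult)
  also have "\<dots> \<le> (\<integral>\<^sup>+u. ?f u + ?f (?flip u) \<partial>\<nu>)"
  proof (intro nn_integral_mono)
    fix u
    have "2 \<le> exp (- ?L u) + exp (?L u)"
      using exp_ge_add_one_self[of "?L u"] exp_ge_add_one_self[of "- ?L u"] by linarith
    then have "?c * 2 \<le> ?c * (exp (- ?L u) + exp (?L u))"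
      by (intro mult_left_mono) auto
    then have "ennreal (2 * ?c) \<le> ennreal (?c * exp (- ?L u) + ?c * exp (?L u))"
      by (intro ennreal_leI) (simp add: algebra_simps)
    then show "2 * (ennreal ?c * indicator ?B u) \<le> ?f u + ?f (?flip u)"
      unfolding flip_L by (auto simp: indicator_def flip_B ennreal_mult)
  qed
  also have "\<dots> = (\<integral>\<^sup>+u. ?f u \<partial>\<nu>) + (\<integral>\<^sup>+u. ?f (?flip u) \<partial>\<nu>)"
    by (intro nn_integral_add) measurable
  also have "(\<integral>\<^sup>+u. ?f (?flip u) \<partial>\<nu>) = (\<integral>\<^sup>+u. ?f u \<partial>\<nu>)"
    by (rule nn_integral_flip[symmetric]) measurable
  finally have "2 * (ennreal ?c * emeasure \<nu> ?B) \<le> 2 * emeasure \<nu> (lp_ball p \<delta> h)"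
    by (simp only: f mult_2)
  then show ?thesis
    by (simp add: ennreal_mult_le_mult_iff emeasure_eq_measure ennreal_mult[symmetric])
qed

text \<open>Truncations of \<open>z\<close> also have energy at most \<open>C\<close>, and a
  slightly smaller ball about a close truncation lies in the ball about \<open>z\<close>.\<close>

lemma prob_lp_ball_ge_energy:
  assumes z: "z \<in> lp p" and C: "\<And>n. energy n z \<le> C" and \<delta>: "0 < \<delta>"
  shows "exp (- C / 2) * prob (lp_ball p \<delta> (\<lambda>k. 0)) \<le> prob (lp_ball p \<delta> z)"
proof -
  have "prob (lp_ball p \<delta> (\<lambda>k. 0)) \<le> exp (C / 2) * prob (lp_ball p \<delta> z)"
  proof (rule prob_lp_ball_le_limit[OF lp_zero _ \<delta>])
    fix r assume r: "0 \<le> r" "r < \<delta>"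
    have "\<forall>\<^sub>F n in sequentially. lp_norm p (\<lambda>k. trunc n z k - z k) < \<delta> - r"
      using r by (intro order_tendstoD(2)[OF lp_norm_trunc_tendsto[OF z]]) auto
    then obtain n where n: "lp_norm p (\<lambda>k. trunc n z k - z k) < \<delta> - r"
      by (auto simp: eventually_sequentially)
    have "energy n (trunc n z) \<le> C"
      using C[of n] by (simp add: energy_def trunc_def)
    then have "exp (- C / 2) * prob (lp_ball p r (\<lambda>k. 0)) \<le> exp (- energy n (trunc n z) / 2) * prob (lp_ball p r (\<lambda>k. 0))"
      by (intro mult_right_mono) auto
    also have "\<dots> \<le> prob (lp_ball p r (trunc n z))"
      by (rule prob_lp_ball_finite_support_ge) (simp add: trunc_def)
    also have "\<dots> \<le> prob (lp_ball p \<delta> z)"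
      using n z by (intro finite_measure_mono lp_ball_subset lp_ball_measurable) auto
    finally show "prob (lp_ball p r (\<lambda>k. 0)) \<le> exp (C / 2) * prob (lp_ball p \<delta> z)"
      by (simp add: exp_minus field_simps)
  qed
  then show ?thesis by (simp add: exp_minus field_simps)
qed

end

section \<open>Compactness and the Cameron--Martin space\<close>

context diagonal_gaussian
begin

text \<open>Separability of \<open>lp p\<close>: lists of rationals form a countable type, and a
  common finite support turns approximation of coordinates into approximation in norm.\<close>

lemma rational_lp_approximation:
  assumes u: "u \<in> lp p" and \<delta>: "0 < \<delta>"
  shows "\<exists>l :: rat list. lp_norm p (\<lambda>k. u k - (if k < length l then real_of_rat (l ! k) else 0)) < \<delta>"
proof -
  have "\<forall>\<^sub>F n in sequentially. lp_norm p (\<lambda>k. trunc n u k - u k) < \<delta> / 2"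
    using \<delta> by (intro order_tendstoD(2)[OF lp_norm_trunc_tendsto[OF u]]) auto
  then obtain n where n: "lp_norm p (\<lambda>k. trunc n u k - u k) < \<delta> / 2"
    by (auto simp: eventually_sequentially)
  have "\<exists>q. \<bar>real_of_rat q - u k\<bar> < inverse (real (Suc m))" for m k
  proof -
    have "u k - inverse (real (Suc m)) < u k + inverse (real (Suc m))" by simp
    then obtain q where "u k - inverse (real (Suc m)) < real_of_rat q" "real_of_rat q < u k + inverse (real (Suc m))"
      using of_rat_dense by blast
    then show ?thesis by (intro exI[of _ q]) linarith
  qed
  then have "\<forall>m. \<exists>q. \<forall>k. \<bar>real_of_rat (q k) - u k\<bar> < inverse (real (Suc m))"
    by (intro allI choice)
  then obtain r where r: "\<And>m k. \<bar>real_of_rat (r m k) - u k\<bar> < inverse (real (Suc m))"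
    by metis
  have "(\<lambda>m. lp_norm p (\<lambda>k. trunc n (\<lambda>k. real_of_rat (r m k)) k - trunc n u k)) \<longlonglongrightarrow> 0"
  proof (rule lp_norm_tendsto_dominated(2)[OF lp_trunc])
    fix m k
    have "inverse (real (Suc m)) \<le> 1" by (simp add: field_simps)
    then have "\<bar>real_of_rat (r m k)\<bar> \<le> \<bar>u k\<bar> + 1" using r[of m k] by linarith
    then show "\<bar>trunc n (\<lambda>k. real_of_rat (r m k)) k\<bar> \<le> \<bar>trunc n (\<lambda>k. \<bar>u k\<bar> + 1) k\<bar>"
      by (simp add: trunc_def)
  next
    fix k
    have "(\<lambda>m. real_of_rat (r m k) - u k) \<longlonglongrightarrow> 0"
      by (rule Lim_null_comparison[OF _ LIMSEQ_inverse_real_of_nat]) (use r in \<open>auto intro!: always_eventually less_imp_le\<close>)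
    then show "(\<lambda>m. trunc n (\<lambda>k. real_of_rat (r m k)) k) \<longlonglongrightarrow> trunc n u k"
      by (auto simp: trunc_def LIM_zero_iff)
  qed
  then have "\<forall>\<^sub>F m in sequentially. lp_norm p (\<lambda>k. trunc n (\<lambda>k. real_of_rat (r m k)) k - trunc n u k) < \<delta> / 2"
    using \<delta> by (intro order_tendstoD(2)) auto
  then obtain m where m: "lp_norm p (\<lambda>k. trunc n (\<lambda>k. real_of_rat (r m k)) k - trunc n u k) < \<delta> / 2"
    by (auto simp: eventually_sequentially)
  have "(\<lambda>k. if k < length (map (r m) [0..<n]) then real_of_rat (map (r m) [0..<n] ! k) else 0) =
      trunc n (\<lambda>k. real_of_rat (r m k))"
    by (auto simp: trunc_def fun_eq_iff)
  moreover have "lp_norm p (\<lambda>k. trunc n (\<lambda>k. real_of_rat (r m k)) k - u k) < \<delta>"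
    using lp_norm_triangle[OF lp_trunc lp_trunc u, of n "\<lambda>k. real_of_rat (r m k)" n u] m n by linarith
  ultimately show ?thesis
    by (intro exI[of _ "map (r m) [0..<n]"]) (simp add: lp_norm_minus fun_eq_iff)
qed

lemma prob_lp: "prob (lp p) = 1"
  using concentrated by (intro prob_eq_1[THEN iffD2]) auto

text \<open>If the centred ball were null, Anderson's inequality would make every ball of that
  radius null; but countably many of them, about rational finite sequences, cover
  \<open>lp p\<close>, which has mass 1.\<close>

lemma prob_lp_ball_pos:
  assumes \<delta>: "0 < \<delta>"
  shows "0 < prob (lp_ball p \<delta> (\<lambda>k. 0))"
proof (rule ccontr)
  assume "\<not> ?thesis"
  then have zero: "prob (lp_ball p \<delta> (\<lambda>k. 0)) = 0"
    by (simp add: less_le)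
  define q where "q = (\<lambda>(l :: rat list) k. if k < length l then real_of_rat (l ! k) else 0)"
  have q: "q l \<in> lp p" for l
    by (rule lp_finite_support[of "length l"]) (simp add: q_def)
  have "prob (lp_ball p \<delta> (q l)) = 0" for l
    using prob_lp_ball_le_centred[OF q \<delta>, of l] zero by (simp add: measure_le_0_iff)
  then have "(\<Union>l. lp_ball p \<delta> (q l)) \<in> null_sets \<nu>"
    by (intro null_sets_UN) (auto simp: null_sets_def emeasure_eq_measure q)
  then have "emeasure \<nu> (\<Union>l. lp_ball p \<delta> (q l)) = 0"
    by (rule null_setsD1)
  moreover have "emeasure \<nu> (lp p) \<le> emeasure \<nu> (\<Union>l. lp_ball p \<delta> (q l))"
  proof (rule emeasure_mono)
    show "lp p \<subseteq> (\<Union>l. lp_ball p \<delta> (q l))"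
      using rational_lp_approximation[OF _ \<delta>] by (fastforce simp: lp_ball_def q_def)
  qed (use q in auto)
  ultimately show False
    using prob_lp by (simp add: emeasure_eq_measure)
qed

lemma prob_tail_tendsto:
  assumes \<delta>: "0 < \<delta>"
  shows "(\<lambda>n. prob {u \<in> lp p. lp_norm p (\<lambda>k. u k - trunc n u k) < \<delta>}) \<longlonglongrightarrow> 1"
    and "{u \<in> lp p. lp_norm p (\<lambda>k. u k - trunc n u k) < \<delta>} \<in> sets \<nu>"
proof -
  let ?A = "\<lambda>n. {u \<in> lp p. lp_norm p (\<lambda>k. u k - trunc n u k) < \<delta>}"
  have A: "?A n \<in> sets \<nu>" for n
  proof -
    have "?A n = {u \<in> space \<nu>. u \<in> lp p \<and> powsum (\<lambda>k. if k < n then 0 else u k) < ennreal (\<delta> powr p)}"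
    proof -
      have eq: "(\<lambda>k. u k - trunc n u k) = (\<lambda>k. if k < n then 0 else u k)" for u
        by (auto simp: trunc_def)
      have "(\<lambda>k. if k < n then 0 else u k) \<in> lp p" if "u \<in> lp p" for u
        by (rule lp_dominated[OF that]) auto
      then show ?thesis
        using \<delta> by (auto simp: eq powsum_eq lp_norm_less_iff ennreal_less_iff suminf_powr_nonneg)
    qed
    also have "\<dots> \<in> sets \<nu>" by measurable
    finally show ?thesis .
  qed
  then show "?A n \<in> sets \<nu>" .
  have "incseq ?A"
  proof (intro monoI subsetI)
    fix m n :: nat and u assume "m \<le> n" "u \<in> ?A m"
    moreover from this have "lp_norm p (\<lambda>k. u k - trunc n u k) \<le> lp_norm p (\<lambda>k. u k - trunc m u k)"
      by (intro lp_norm_mono lp_diff lp_trunc) (auto simp: trunc_def)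
    ultimately show "u \<in> ?A n" by auto
  qed
  then have "(\<lambda>n. prob (?A n)) \<longlonglongrightarrow> prob (\<Union>n. ?A n)"
    using A by (intro finite_Lim_measure_incseq) auto
  moreover have "(\<Union>n. ?A n) = lp p"
  proof safe
    fix u assume u: "u \<in> lp p"
    have "\<forall>\<^sub>F n in sequentially. lp_norm p (\<lambda>k. trunc n u k - u k) < \<delta>"
      using \<delta> by (intro order_tendstoD(2)[OF lp_norm_trunc_tendsto[OF u]]) auto
    then obtain n where "lp_norm p (\<lambda>k. u k - trunc n u k) < \<delta>"
      by (auto simp: eventually_sequentially lp_norm_minus)
    with u show "u \<in> (\<Union>n. ?A n)" by auto
  qed
  ultimately show "(\<lambda>n. prob (?A n)) \<longlonglongrightarrow> 1" using prob_lp by simp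
qed

text \<open>
  Balls centred at points of bounded energy have mass bounded below, so they all meet a set of
  almost full mass, on which the tails are uniformly small.
\<close>

lemma energy_tail_uniform:
  assumes \<delta>: "0 < \<delta>"
  shows "\<exists>n. \<forall>g\<in>lp p. (\<forall>m. energy m g \<le> C) \<longrightarrow> lp_norm p (\<lambda>k. g k - trunc n g k) \<le> \<delta>"
proof -
  let ?A = "\<lambda>n. {u \<in> lp p. lp_norm p (\<lambda>k. u k - trunc n u k) < \<delta> / 2}"
  define c where "c = exp (- C / 2) * prob (lp_ball p (\<delta> / 2) (\<lambda>k. 0))"
  have "0 < c" unfolding c_def using \<delta> by (intro mult_pos_pos prob_lp_ball_pos) auto
  then have "\<forall>\<^sub>F n in sequentially. 1 - c < prob (?A n)"
    using \<delta> by (intro order_tendstoD(1)[OF prob_tail_tendsto(1)]) auto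
  then obtain n where n: "1 - c < prob (?A n)"
    by (auto simp: eventually_sequentially)
  show ?thesis
  proof (intro exI[of _ n] ballI impI)
    fix g assume g: "g \<in> lp p" and "\<forall>m. energy m g \<le> C"
    then have "c \<le> prob (lp_ball p (\<delta> / 2) g)"
      unfolding c_def using \<delta> by (intro prob_lp_ball_ge_energy) auto
    then have "1 < prob (?A n) + prob (lp_ball p (\<delta> / 2) g)" using n by linarith
    moreover have "prob (?A n \<union> lp_ball p (\<delta> / 2) g) = prob (?A n) + prob (lp_ball p (\<delta> / 2) g)"
      if "?A n \<inter> lp_ball p (\<delta> / 2) g = {}"
      using g \<delta> that by (intro finite_measure_Union prob_tail_tendsto(2) lp_ball_measurable) auto
    ultimately have "?A n \<inter> lp_ball p (\<delta> / 2) g \<noteq> {}"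
      using prob_le_1[of "?A n \<union> lp_ball p (\<delta> / 2) g"] by linarith
    then obtain u where u: "u \<in> lp p" "lp_norm p (\<lambda>k. u k - trunc n u k) < \<delta> / 2" "lp_norm p (\<lambda>k. u k - g k) < \<delta> / 2"
      by (auto simp: lp_ball_def)
    have "lp_norm p (\<lambda>k. g k - trunc n g k) \<le>
        lp_norm p (\<lambda>k. (g k - trunc n g k) - (u k - trunc n u k)) + lp_norm p (\<lambda>k. u k - trunc n u k)"
      using g u by (intro lp_norm_triangle_sub lp_diff) auto
    also have "lp_norm p (\<lambda>k. (g k - trunc n g k) - (u k - trunc n u k)) \<le> lp_norm p (\<lambda>k. u k - g k)"
      using g u by (intro lp_norm_mono lp_diff) (auto simp: trunc_def)
    finally show "lp_norm p (\<lambda>k. g k - trunc n g k) \<le> \<delta>" using u by linarith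
  qed
qed

section \<open>Compactness of sets of bounded energy\<close>

lemma abs_le_of_energy_le:
  assumes "energy (Suc k) h \<le> C"
  shows "\<bar>h k\<bar> \<le> sqrt C * \<sigma> k"
proof -
  have "(h k)\<^sup>2 / (\<sigma> k)\<^sup>2 \<le> energy (Suc k) h"
    unfolding energy_def by (rule member_le_sum[of k]) auto
  with assms have "(h k / \<sigma> k)\<^sup>2 \<le> C" by (simp add: power_divide)
  then have "\<bar>h k / \<sigma> k\<bar> \<le> sqrt C" by (metis real_sqrt_abs real_sqrt_le_mono)
  then show ?thesis using sigma_pos[of k] by (simp add: abs_divide pos_divide_le_eq)
qed

text \<open>The uniform tail estimate presupposes membership in \<open>lp p\<close>, so it is
  applied to the truncations of \<open>z\<close>: one \<open>n\<close> serves all of them and bounds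
  the partial sums of \<open>\<bar>z k\<bar> powr p\<close>.\<close>

lemma energy_bounded_lp:
  assumes "\<And>m. energy m z \<le> C"
  shows "z \<in> lp p"
proof -
  obtain n where n: "\<And>g. g \<in> lp p \<Longrightarrow> (\<forall>m. energy m g \<le> C) \<Longrightarrow> lp_norm p (\<lambda>k. g k - trunc n g k) \<le> 1"
    using energy_tail_uniform[of 1 C] by auto
  define B where "B = 1 + lp_norm p (trunc n z)"
  have "(\<Sum>k<l. \<bar>z k\<bar> powr p) \<le> B powr p" for l
  proof -
    have "energy m (trunc l z) \<le> C" for m
      by (rule order_trans[OF energy_mono assms[of m]]) (simp add: trunc_def)
    then have "lp_norm p (\<lambda>k. trunc l z k - trunc n (trunc l z) k) \<le> 1" by (intro n) auto
    moreover have "lp_norm p (trunc n (trunc l z)) \<le> lp_norm p (trunc n z)"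
      by (rule lp_norm_mono[OF lp_trunc]) (auto simp: trunc_def)
    ultimately have "lp_norm p (trunc l z) \<le> B"
      using lp_norm_triangle_sub[OF lp_trunc lp_trunc, of l z n "trunc l z"] unfolding B_def by linarith
    then have "lp_norm p (trunc l z) powr p \<le> B powr p"
      using p_pos by (intro powr_mono2) auto
    moreover have "lp_norm p (trunc l z) powr p = (\<Sum>k<l. \<bar>trunc l z k\<bar> powr p)"
      by (subst lp_norm_finite_support[of l]) (auto simp: trunc_def powr_powr sum_nonneg)
    ultimately show ?thesis by (simp add: trunc_def)
  qed
  then show ?thesis
    unfolding lp_def mem_Collect_eq by (intro summableI_nonneg_bounded) auto
qed

text \<open>Tychonoff's theorem gives a coordinatewise limit whose energy is again bounded.
  Uniformly small tails leave finitely many coordinates, where coordinatewise and norm convergence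
  agree. This is the compact embedding of the Cameron-Martin space.\<close>

lemma energy_bounded_compact:
  assumes C: "\<And>i m. energy m (h i) \<le> C"
  obtains z r where "strict_mono (r :: nat \<Rightarrow> nat)" "z \<in> lp p" "(\<lambda>i. lp_norm p (\<lambda>k. h (r i) k - z k)) \<longlonglongrightarrow> 0"
proof -
  have hlp: "h i \<in> lp p" for i by (rule energy_bounded_lp) (rule C)
  have box: "\<bar>h i k\<bar> \<le> sqrt C * \<sigma> k" for i k by (rule abs_le_of_energy_le) (rule C)
  obtain z r where r: "strict_mono (r :: nat \<Rightarrow> nat)" and "(h \<circ> r) \<longlonglongrightarrow> z"
    using compact_imp_seq_compact[OF compact_coordinate_box[of "\<lambda>k. sqrt C * \<sigma> k"]] box
    unfolding seq_compact_def by blast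
  then have lim: "(\<lambda>i. h (r i) k) \<longlonglongrightarrow> z k" for k
    using continuous_on_tendsto_compose[OF continuous_on_product_coordinates[of k], of "h \<circ> r" z]
    by (auto simp: o_def)
  have zC: "energy m z \<le> C" for m
    by (rule LIMSEQ_le_const2[OF energy_tendsto[OF lim]]) (use C in auto)
  have z: "z \<in> lp p" by (rule energy_bounded_lp) (rule zC)
  have "(\<lambda>i. lp_norm p (\<lambda>k. h (r i) k - z k)) \<longlonglongrightarrow> 0"
  proof (rule LIMSEQ_I)
    fix e :: real assume e: "0 < e"
    obtain n where n: "\<And>g. g \<in> lp p \<Longrightarrow> (\<forall>m. energy m g \<le> C) \<Longrightarrow> lp_norm p (\<lambda>k. g k - trunc n g k) \<le> e / 4"
      using energy_tail_uniform[of "e / 4" C] e by auto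
    have "(\<lambda>i. lp_norm p (\<lambda>k. trunc n (h (r i)) k - trunc n z k)) \<longlonglongrightarrow> 0"
    proof (rule lp_norm_tendsto_dominated(2)[OF lp_trunc])
      show "\<bar>trunc n (h (r i)) k\<bar> \<le> \<bar>trunc n (\<lambda>k. sqrt C * \<sigma> k) k\<bar>" for i k
        using box[of "r i" k] by (auto simp: trunc_def)
      show "(\<lambda>i. trunc n (h (r i)) k) \<longlonglongrightarrow> trunc n z k" for k
        using lim[of k] by (auto simp: trunc_def)
    qed
    then have "\<forall>\<^sub>F i in sequentially. lp_norm p (\<lambda>k. trunc n (h (r i)) k - trunc n z k) < e / 4"
      using e by (intro order_tendstoD(2)) auto
    then obtain N where N: "\<And>i. N \<le> i \<Longrightarrow> lp_norm p (\<lambda>k. trunc n (h (r i)) k - trunc n z k) < e / 4"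
      by (auto simp: eventually_sequentially)
    have "norm (lp_norm p (\<lambda>k. h (r i) k - z k) - 0) < e" if "N \<le> i" for i
    proof -
      have "lp_norm p (\<lambda>k. h (r i) k - trunc n (h (r i)) k) \<le> e / 4" using hlp C by (intro n) auto
      moreover have "lp_norm p (\<lambda>k. trunc n z k - z k) \<le> e / 4"
        using z zC by (subst lp_norm_minus) (intro n, auto)
      ultimately have "lp_norm p (\<lambda>k. h (r i) k - z k) < e"
        using N[OF that] lp_norm_triangle[OF hlp lp_trunc z, of "r i" n "h (r i)"]
          lp_norm_triangle[OF lp_trunc lp_trunc z, of n "h (r i)" n z] e by linarith
      then show ?thesis by simp
    qed
    then show "\<exists>N. \<forall>i\<ge>N. norm (lp_norm p (\<lambda>k. h (r i) k - z k) - 0) < e" by blast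
  qed
  with r z show thesis by (rule that)
qed

section \<open>Continuous functionals and the Cameron-Martin norm\<close>

abbreviation \<mu> :: "(nat \<Rightarrow> real) measure" where
  "\<mu> \<equiv> gauss_lp p \<sigma>"

lemma nn_integral_gauss_lp:
  "(\<integral>\<^sup>+u. f u \<partial>\<mu>) = (\<integral>\<^sup>+u. f u * indicator (lp p) u \<partial>\<nu>)"
  unfolding gauss_lp_def by (rule nn_integral_restrict_space) simp

definition unit_seq :: "nat \<Rightarrow> nat \<Rightarrow> real" where
  "unit_seq n = (\<lambda>k. if k = n then 1 else 0)"

lemma unit_seq_lp [simp]: "unit_seq n \<in> lp p"
  by (rule lp_finite_support[of "Suc n"]) (simp add: unit_seq_def)

context
  fixes l assumes l: "l \<in> lp_dual p"
begin

lemma lp_dual_add: "x \<in> lp p \<Longrightarrow> y \<in> lp p \<Longrightarrow> l (\<lambda>k. x k + y k) = l x + l y"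
  using l by (simp add: lp_dual_def)

lemma lp_dual_scale: "x \<in> lp p \<Longrightarrow> l (\<lambda>k. c * x k) = c * l x"
  using l by (simp add: lp_dual_def)

lemma lp_dual_trunc: "l (trunc n u) = (\<Sum>k<n. l (unit_seq k) * u k)"
proof (induction n)
  case 0
  show ?case using lp_dual_scale[OF lp_zero, of 0] by simp
next
  case (Suc n)
  have "trunc (Suc n) u = (\<lambda>k. trunc n u k + u n * unit_seq n k)"
    by (auto simp: trunc_def unit_seq_def less_Suc_eq)
  then show ?case
    using lp_dual_add[OF lp_trunc lp_scale[OF unit_seq_lp], of n u "u n" n] Suc
    by (simp add: lp_dual_scale mult.commute)
qed

lemma lp_dual_trunc_tendsto:
  assumes u: "u \<in> lp p"
  shows "(\<lambda>n. l (trunc n u)) \<longlonglongrightarrow> l u"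
proof -
  obtain C where C: "\<And>x. x \<in> lp p \<Longrightarrow> \<bar>l x\<bar> \<le> C * lp_norm p x"
    using l unfolding lp_dual_def by blast
  have "l (\<lambda>k. trunc n u k + -1 * u k) = l (trunc n u) + -1 * l u" for n
    by (subst lp_dual_add[OF lp_trunc lp_scale[OF u]]) (simp only: lp_dual_scale[OF u])
  then have "l (\<lambda>k. trunc n u k - u k) = l (trunc n u) - l u" for n
    by simp
  then have le: "\<bar>l (trunc n u) - l u\<bar> \<le> C * lp_norm p (\<lambda>k. trunc n u k - u k)" for n
    using C[OF lp_diff[OF lp_trunc u], of n u] by simp
  have "(\<lambda>n. C * lp_norm p (\<lambda>k. trunc n u k - u k)) \<longlonglongrightarrow> 0"
    using tendsto_mult[OF tendsto_const[of C] lp_norm_trunc_tendsto[OF u]] by simp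
  then have "(\<lambda>n. l (trunc n u) - l u) \<longlonglongrightarrow> 0"
    by (rule Lim_null_comparison[rotated]) (use le in \<open>simp add: always_eventually\<close>)
  then show ?thesis by (simp add: LIM_zero_iff)
qed

text \<open>Continuity makes \<open>l\<close> a pointwise limit, on \<open>lp p\<close>, of finite
  linear combinations of coordinates. Outside \<open>lp p\<close> the values of \<open>l\<close> are
  arbitrary and are replaced by 0.\<close>

lemma lp_dual_measurable [measurable]: "(\<lambda>u. if u \<in> lp p then l u else 0) \<in> borel_measurable \<nu>"
proof (rule borel_measurable_LIMSEQ_real)
  show "(\<lambda>n. if u \<in> lp p then (\<Sum>k<n. l (unit_seq k) * u k) else 0) \<longlonglongrightarrow> (if u \<in> lp p then l u else 0)" for u
    using lp_dual_trunc_tendsto[of u] by (simp add: lp_dual_trunc)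
  show "(\<lambda>u. if u \<in> lp p then (\<Sum>k<n. l (unit_seq k) * u k) else 0) \<in> borel_measurable \<nu>" for n
    by measurable
qed

text \<open>Flipping the signs of the first \<open>n\<close> coordinates decorrelates them from the remaining ones.\<close>

lemma second_moment_trunc_le:
  "(\<integral>\<^sup>+u. ennreal ((\<Sum>k<n. l (unit_seq k) * u k)\<^sup>2) \<partial>\<nu>) \<le> (\<integral>\<^sup>+u. ennreal ((l u)\<^sup>2) \<partial>\<mu>)"
proof -
  let ?G = "\<lambda>u. if u \<in> lp p then l u else 0"
  let ?S = "\<lambda>u. \<Sum>k<n. l (unit_seq k) * u k"
  let ?flip = "\<lambda>u k. if k < n then - u k else u k"
  have [measurable]: "?flip \<in> measurable \<nu> \<nu>"
    by (rule coordinatewise_measurable) auto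
  have [measurable]: "(\<lambda>u. ?G (?flip u)) \<in> borel_measurable \<nu>"
    by (rule measurable_compose[OF _ lp_dual_measurable]) measurable
  have G: "(\<integral>\<^sup>+u. ennreal ((l u)\<^sup>2) \<partial>\<mu>) = (\<integral>\<^sup>+u. ennreal ((?G u)\<^sup>2) \<partial>\<nu>)"
    unfolding nn_integral_gauss_lp by (intro nn_integral_cong) (auto simp: indicator_def)
  have "2 * (\<integral>\<^sup>+u. ennreal ((?S u)\<^sup>2) \<partial>\<nu>) = (\<integral>\<^sup>+u. 2 * ennreal ((?S u)\<^sup>2) \<partial>\<nu>)"
    by (rule nn_integral_cmult[symmetric]) measurable
  also have "\<dots> \<le> (\<integral>\<^sup>+u. ennreal ((?G u)\<^sup>2) + ennreal ((?G (?flip u))\<^sup>2) \<partial>\<nu>)"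
  proof (rule nn_integral_mono_AE, use concentrated in eventually_elim)
    fix u assume u: "u \<in> lp p"
    define w where "w = (\<lambda>k. u k - trunc n u k)"
    have w: "w \<in> lp p" unfolding w_def using u by (intro lp_diff) auto
    have fl: "?flip u \<in> lp p" by (rule lp_dominated[OF u]) auto
    have "l u = l (\<lambda>k. trunc n u k + w k)" by (simp add: w_def)
    then have 1: "l u = ?S u + l w" using w by (simp add: lp_dual_add lp_dual_trunc)
    have "?flip u = (\<lambda>k. -1 * trunc n u k + w k)" by (auto simp: w_def trunc_def)
    then have "l (?flip u) = -1 * l (trunc n u) + l w"
      using w lp_dual_add[OF lp_scale[OF lp_trunc] w] lp_dual_scale[OF lp_trunc] by metis
    then have 2: "l (?flip u) = - ?S u + l w" by (simp add: lp_dual_trunc)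
    have "2 * (?S u)\<^sup>2 \<le> (l u)\<^sup>2 + (l (?flip u))\<^sup>2"
      unfolding 1 2 by (simp add: power2_eq_square algebra_simps)
    then have "ennreal (2 * (?S u)\<^sup>2) \<le> ennreal ((l u)\<^sup>2 + (l (?flip u))\<^sup>2)" by (rule ennreal_leI)
    then show "2 * ennreal ((?S u)\<^sup>2) \<le> ennreal ((?G u)\<^sup>2) + ennreal ((?G (?flip u))\<^sup>2)"
      using u fl by (simp add: ennreal_mult)
  qed
  also have "\<dots> = (\<integral>\<^sup>+u. ennreal ((?G u)\<^sup>2) \<partial>\<nu>) + (\<integral>\<^sup>+u. ennreal ((?G (?flip u))\<^sup>2) \<partial>\<nu>)"
    by (rule nn_integral_add) measurable
  also have "(\<integral>\<^sup>+u. ennreal ((?G (?flip u))\<^sup>2) \<partial>\<nu>) = (\<integral>\<^sup>+u. ennreal ((?G u)\<^sup>2) \<partial>\<nu>)"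
    by (rule nn_integral_flip[symmetric]) measurable
  finally have "2 * (\<integral>\<^sup>+u. ennreal ((?S u)\<^sup>2) \<partial>\<nu>) \<le> 2 * (\<integral>\<^sup>+u. ennreal ((?G u)\<^sup>2) \<partial>\<nu>)"
    by (simp only: mult_2)
  then show ?thesis unfolding G by (simp add: ennreal_mult_le_mult_iff)
qed

end

lemma nn_integral_coordinate_square: "(\<integral>\<^sup>+u. ennreal ((u k)\<^sup>2) \<partial>\<nu>) = ennreal ((\<sigma> k)\<^sup>2)"
proof -
  have hb: "has_bochner_integral lborel (\<lambda>x. normal_density 0 (\<sigma> k) x * x\<^sup>2) ((\<sigma> k)\<^sup>2)"
    using normal_moment_even[OF sigma_pos[of k], where \<mu> = 0 and k = 1] by (simp add: numeral_2_eq_2)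
  have "(\<integral>\<^sup>+x. ennreal (normal_density 0 (\<sigma> k) x) * ennreal (x\<^sup>2) \<partial>lborel)
      = (\<integral>\<^sup>+x. ennreal (normal_density 0 (\<sigma> k) x * x\<^sup>2) \<partial>lborel)"
    by (simp add: ennreal_mult)
  also have "\<dots> = ennreal ((\<sigma> k)\<^sup>2)"
    using hb by (subst nn_integral_eq_integral) (auto simp: has_bochner_integral_iff)
  finally show ?thesis
    by (subst nn_integral_coordinate[of _ k]) (auto simp: emeasure_space_1[simplified])
qed

text \<open>Averaging over the sign of coordinate \<open>n\<close> cancels the mixed product in the
  square. The computation stays within nonnegative integrals, so integrability of the mixed product
  never has to be discussed.\<close>

lemma nn_integral_linear_square:
  "(\<integral>\<^sup>+u. ennreal ((\<Sum>k<n. a k * u k)\<^sup>2) \<partial>\<nu>) = ennreal (\<Sum>k<n. (a k)\<^sup>2 * (\<sigma> k)\<^sup>2)"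
proof (induction n)
  case (Suc n)
  let ?S = "\<lambda>u. \<Sum>k<n. a k * u k"
  let ?f = "\<lambda>u. ennreal ((?S u + a n * u n)\<^sup>2)"
  have upd: "?f (u(n := - u n)) = ennreal ((?S u - a n * u n)\<^sup>2)" for u
  proof -
    have "?S (u(n := - u n)) = ?S u" by (rule sum.cong) auto
    then show ?thesis by simp
  qed
  have "(\<integral>\<^sup>+u. ?f u \<partial>\<nu>) = (\<integral>\<^sup>+u. ?f (u(n := - u n)) \<partial>\<nu>)"
    by (rule nn_integral_flip_coordinate) measurable
  then have "2 * (\<integral>\<^sup>+u. ?f u \<partial>\<nu>) = (\<integral>\<^sup>+u. ?f u \<partial>\<nu>) + (\<integral>\<^sup>+u. ennreal ((?S u - a n * u n)\<^sup>2) \<partial>\<nu>)"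
    unfolding upd by (simp only: mult_2)
  also have "\<dots> = (\<integral>\<^sup>+u. ?f u + ennreal ((?S u - a n * u n)\<^sup>2) \<partial>\<nu>)"
    by (rule nn_integral_add[symmetric]) measurable
  also have "\<dots> = (\<integral>\<^sup>+u. 2 * (ennreal ((?S u)\<^sup>2) + ennreal ((a n)\<^sup>2) * ennreal ((u n)\<^sup>2)) \<partial>\<nu>)"
  proof (rule nn_integral_cong)
    fix u
    have "(?S u + a n * u n)\<^sup>2 + (?S u - a n * u n)\<^sup>2 = 2 * ((?S u)\<^sup>2 + (a n)\<^sup>2 * (u n)\<^sup>2)"
      by (simp add: power2_eq_square algebra_simps)
    then have "?f u + ennreal ((?S u - a n * u n)\<^sup>2) = ennreal (2 * ((?S u)\<^sup>2 + (a n)\<^sup>2 * (u n)\<^sup>2))"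
      by (simp only: ennreal_plus[symmetric] zero_le_power2)
    then show "?f u + ennreal ((?S u - a n * u n)\<^sup>2) = 2 * (ennreal ((?S u)\<^sup>2) + ennreal ((a n)\<^sup>2) * ennreal ((u n)\<^sup>2))"
      by (simp only: ennreal_mult ennreal_plus zero_le_power2 mult_nonneg_nonneg add_nonneg_nonneg zero_le_numeral ennreal_numeral)
  qed
  also have "\<dots> = 2 * ((\<integral>\<^sup>+u. ennreal ((?S u)\<^sup>2) \<partial>\<nu>) + ennreal ((a n)\<^sup>2) * (\<integral>\<^sup>+u. ennreal ((u n)\<^sup>2) \<partial>\<nu>))"
    by (simp add: nn_integral_cmult nn_integral_add)
  finally have "(\<integral>\<^sup>+u. ?f u \<partial>\<nu>) = ennreal (\<Sum>k<n. (a k)\<^sup>2 * (\<sigma> k)\<^sup>2) + ennreal ((a n)\<^sup>2) * ennreal ((\<sigma> n)\<^sup>2)"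
    unfolding Suc nn_integral_coordinate_square by (simp add: ennreal_mult_cancel_left del: distrib_left_numeral)
  then show ?case
    by (simp add: ennreal_mult[symmetric] sum_nonneg)
qed simp

lemma finite_linear_lp_dual: "(\<lambda>u. \<Sum>k<n. a k * u k) \<in> lp_dual p"
proof -
  have "\<bar>\<Sum>k<n. a k * x k\<bar> \<le> (\<Sum>k<n. \<bar>a k\<bar>) * lp_norm p x" if "x \<in> lp p" for x
  proof -
    have "\<bar>\<Sum>k<n. a k * x k\<bar> \<le> (\<Sum>k<n. \<bar>a k\<bar> * \<bar>x k\<bar>)"
      by (rule order_trans[OF sum_abs]) (simp add: abs_mult)
    also have "\<dots> \<le> (\<Sum>k<n. \<bar>a k\<bar> * lp_norm p x)"
      using that by (intro sum_mono mult_left_mono abs_le_lp_norm) auto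
    finally show ?thesis by (simp add: sum_distrib_right)
  qed
  then show ?thesis
    unfolding lp_dual_def mem_Collect_eq
    by (intro conjI exI[of _ "\<Sum>k<n. \<bar>a k\<bar>"] ballI allI)
      (auto simp: sum.distrib[symmetric] sum_distrib_left algebra_simps)
qed

text \<open>For the coefficients \<open>a k = l (unit_seq k)\<close>, the variance bound gives
  \<open>(\<Sum>k<n. (a k)\<^sup>2 * (\<sigma> k)\<^sup>2) \<le> 1\<close>. Cauchy-Schwarz pairs
  \<open>a k * \<sigma> k\<close> with \<open>h k / \<sigma> k\<close>, and continuity carries the
  bound from truncations to \<open>h\<close>.\<close>

lemma cm_functionals_le:
  assumes l: "l \<in> cm_functionals p \<mu>" and h: "h \<in> lp p" and C: "\<And>n. energy n h \<le> C"
  shows "l h \<le> sqrt C"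
proof -
  have dual: "l \<in> lp_dual p" and var: "(\<integral>\<^sup>+u. ennreal ((l u)\<^sup>2) \<partial>\<mu>) \<le> 1"
    using l by (auto simp: cm_functionals_def)
  have "l (trunc n h) \<le> sqrt C" for n
  proof -
    let ?a = "\<lambda>k. l (unit_seq k)"
    have "ennreal (\<Sum>k<n. (?a k)\<^sup>2 * (\<sigma> k)\<^sup>2) \<le> 1"
      using order_trans[OF second_moment_trunc_le[OF dual] var] by (simp add: nn_integral_linear_square)
    then have a: "(\<Sum>k<n. (?a k)\<^sup>2 * (\<sigma> k)\<^sup>2) \<le> 1"
      by (simp add: ennreal_le_1)
    have "l (trunc n h) = (\<Sum>k<n. (?a k * \<sigma> k) * (h k / \<sigma> k))"
      by (simp add: lp_dual_trunc[OF dual])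
    also have "\<dots> \<le> (\<Sum>k<n. \<bar>?a k * \<sigma> k\<bar> * \<bar>h k / \<sigma> k\<bar>)"
      by (intro sum_mono) (metis abs_ge_self abs_mult)
    also have "\<dots> \<le> L2_set (\<lambda>k. ?a k * \<sigma> k) {..<n} * L2_set (\<lambda>k. h k / \<sigma> k) {..<n}"
      by (rule L2_set_mult_ineq)
    also have "\<dots> \<le> 1 * sqrt C"
      unfolding L2_set_def using a C[of n]
      by (intro mult_mono) (auto simp: power_mult_distrib power_divide energy_def sum_nonneg)
    finally show ?thesis by simp
  qed
  then show ?thesis
    by (intro LIMSEQ_le_const2[OF lp_dual_trunc_tendsto[OF dual h]]) auto
qed

lemma cm_functionals_attain:
  "\<exists>l\<in>cm_functionals p \<mu>. l h = sqrt (energy n h)"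
proof -
  define s where "s = sqrt (energy n h)"
  \<comment> \<open>The coefficients of equality in Cauchy-Schwarz, scaled to variance 1. If the
    energy is 0, division by zero makes \<open>a\<close> vanish, and the zero functional has the
    required value.\<close>
  define a where "a = (\<lambda>k. h k / (\<sigma> k)\<^sup>2 / s)"
  let ?l = "\<lambda>u. \<Sum>k<n. a k * u k"
  have s2: "s\<^sup>2 = energy n h" by (simp add: s_def energy_nonneg)
  have var: "(\<Sum>k<n. (a k)\<^sup>2 * (\<sigma> k)\<^sup>2) = energy n h / s\<^sup>2"
    unfolding energy_def sum_divide_distrib a_def
    by (intro sum.cong) (auto simp: power_divide power2_eq_square)
  have "(\<integral>\<^sup>+u. ennreal ((?l u)\<^sup>2) \<partial>\<mu>) \<le> (\<integral>\<^sup>+u. ennreal ((?l u)\<^sup>2) \<partial>\<nu>)"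
    unfolding nn_integral_gauss_lp by (intro nn_integral_mono) (auto simp: indicator_def)
  also have "\<dots> \<le> 1"
    unfolding nn_integral_linear_square var s2 by (simp add: ennreal_le_1)
  finally have "?l \<in> cm_functionals p \<mu>"
    by (simp add: cm_functionals_def finite_linear_lp_dual)
  moreover have "?l h = energy n h / s"
    unfolding energy_def sum_divide_distrib a_def by (intro sum.cong) (auto simp: power2_eq_square)
  then have "?l h = s"
    unfolding s2[symmetric] by (simp add: power2_eq_square)
  ultimately show ?thesis unfolding s_def by (rule bexI[where x = ?l, rotated])
qed

text \<open>Functionals attaining \<open>sqrt (energy n h)\<close> force a bound on every partial
  energy; conversely a common bound on these energies controls all functionals of variance at most
  1.\<close>

lemma cm_space_iff: "h \<in> cm_space p \<mu> \<longleftrightarrow> h \<in> lp p \<and> (\<exists>C. \<forall>n. energy n h \<le> C)"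
proof safe
  assume h: "h \<in> cm_space p \<mu>"
  then show "h \<in> lp p" by (simp add: cm_space_def)
  from h obtain B where B: "\<And>l. l \<in> cm_functionals p \<mu> \<Longrightarrow> l h \<le> B"
    by (auto simp: cm_space_def bdd_above_def)
  have "energy n h \<le> B\<^sup>2" for n
  proof -
    have "sqrt (energy n h) \<le> B" using cm_functionals_attain[of h n] B by metis
    then have "(sqrt (energy n h))\<^sup>2 \<le> B\<^sup>2" by (intro power_mono) (auto simp: energy_nonneg)
    then show ?thesis by (simp add: energy_nonneg)
  qed
  then show "\<exists>C. \<forall>n. energy n h \<le> C" by blast
next
  fix C assume "h \<in> lp p" "\<forall>n. energy n h \<le> C"
  moreover from this have "bdd_above ((\<lambda>l. l h) ` cm_functionals p \<mu>)"
    by (intro bdd_aboveI2[where M = "sqrt C"]) (rule cm_functionals_le, auto)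
  ultimately show "h \<in> cm_space p \<mu>"
    by (simp add: cm_space_def)
qed

text \<open>Together with \<open>cm_norm_le\<close> this makes the square of \<open>cm_norm\<close>
  the supremum of the energies, the only information on \<open>cm_norm\<close> used later.\<close>

lemma energy_le_cm_norm:
  assumes "h \<in> cm_space p \<mu>"
  shows "energy n h \<le> (cm_norm p \<mu> h)\<^sup>2"
proof -
  obtain l where l: "l \<in> cm_functionals p \<mu>" "l h = sqrt (energy n h)"
    using cm_functionals_attain by blast
  have "l h \<le> cm_norm p \<mu> h"
    unfolding cm_norm_def using assms l(1) by (intro cSUP_upper) (auto simp: cm_space_def)
  then have "(sqrt (energy n h))\<^sup>2 \<le> (cm_norm p \<mu> h)\<^sup>2"
    unfolding l(2) by (intro power_mono) (auto simp: energy_nonneg)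
  then show ?thesis by (simp add: energy_nonneg)
qed

lemma cm_norm_le:
  assumes "h \<in> lp p" "\<And>n. energy n h \<le> C"
  shows "(cm_norm p \<mu> h)\<^sup>2 \<le> C"
proof -
  have h: "h \<in> cm_space p \<mu>" using assms by (auto simp: cm_space_iff)
  have "cm_norm p \<mu> h \<le> sqrt C"
    unfolding cm_norm_def using cm_functionals_attain[of h 0] assms
    by (intro cSUP_least cm_functionals_le) auto
  moreover have "0 \<le> cm_norm p \<mu> h"
  proof -
    obtain l where l: "l \<in> cm_functionals p \<mu>" "l h = sqrt (energy 0 h)"
      using cm_functionals_attain by blast
    then have "0 \<le> l h" by (simp add: energy_nonneg)
    also have "l h \<le> cm_norm p \<mu> h"
      unfolding cm_norm_def using h l(1) by (intro cSUP_upper) (auto simp: cm_space_def)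
    finally show ?thesis .
  qed
  ultimately have "(cm_norm p \<mu> h)\<^sup>2 \<le> (sqrt C)\<^sup>2" by (intro power_mono)
  moreover have "0 \<le> C" using assms(2)[of 0] energy_nonneg[of 0 h] by linarith
  ultimately show ?thesis by simp
qed

end

section \<open>Maximisers of posterior ball masses\<close>

locale gaussian_posterior = diagonal_gaussian +
  fixes \<Phi> :: "(nat \<Rightarrow> real) \<Rightarrow> real"
  assumes admissible: "admissible_potential p \<Phi>"
begin

definition Z :: real where
  "Z = (\<integral>u. exp (- \<Phi> u) \<partial>\<mu>)"

abbreviation mass :: "real \<Rightarrow> (nat \<Rightarrow> real) \<Rightarrow> real" where
  "mass \<delta> x \<equiv> measure (posterior \<mu> \<Phi>) (lp_ball p \<delta> x)"

abbreviation centred :: "real \<Rightarrow> real" where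
  "centred \<delta> \<equiv> prob (lp_ball p \<delta> (\<lambda>k. 0))"

abbreviation OM :: "(nat \<Rightarrow> real) \<Rightarrow> real" where
  "OM \<equiv> onsager_machlup p \<mu> \<Phi>"

lemma potential_bounded_below: "\<exists>M. \<forall>u\<in>lp p. M \<le> \<Phi> u"
  using admissible by (simp add: admissible_potential_def)

lemma potential_bounded_above: "\<exists>K. \<forall>u\<in>lp p. lp_norm p u < r \<longrightarrow> \<Phi> u \<le> K"
proof -
  have "max r 1 > 0" by simp
  then obtain K where "\<forall>u\<in>lp p. lp_norm p u < max r 1 \<longrightarrow> \<Phi> u \<le> K"
    using admissible unfolding admissible_potential_def by blast
  then show ?thesis by (intro exI[of _ K]) auto
qed

lemma potential_lipschitz:
  "\<exists>L>0. \<forall>u\<in>lp p. \<forall>v\<in>lp p. lp_norm p u \<le> r \<longrightarrow> lp_norm p v \<le> r \<longrightarrow>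
    \<bar>\<Phi> u - \<Phi> v\<bar> \<le> L * lp_norm p (\<lambda>k. u k - v k)"
proof -
  have "max r 1 > 0" by simp
  then obtain L where "0 < L" "\<forall>u\<in>lp p. \<forall>v\<in>lp p. lp_norm p u \<le> max r 1 \<longrightarrow> lp_norm p v \<le> max r 1 \<longrightarrow>
    \<bar>\<Phi> u - \<Phi> v\<bar> \<le> L * lp_norm p (\<lambda>k. u k - v k)"
    using admissible unfolding admissible_potential_def by blast
  then show ?thesis by (intro exI[of _ L]) auto
qed

lemma eventually_lp_norm_less:
  assumes x: "\<And>n. x n \<in> lp p" and z: "z \<in> lp p" and lim: "(\<lambda>n. lp_norm p (\<lambda>k. x n k - z k)) \<longlonglongrightarrow> 0"
  shows "\<forall>\<^sub>F n in sequentially. lp_norm p (x n) < lp_norm p z + 1"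
proof -
  have "\<forall>\<^sub>F n in sequentially. lp_norm p (\<lambda>k. x n k - z k) < 1"
    by (rule order_tendstoD(2)[OF lim]) simp
  then show ?thesis
  proof eventually_elim
    case (elim n)
    with lp_norm_triangle_sub[OF x z, of n] show ?case by linarith
  qed
qed

lemma potential_tendsto:
  assumes x: "\<And>n. x n \<in> lp p" and z: "z \<in> lp p" and lim: "(\<lambda>n. lp_norm p (\<lambda>k. x n k - z k)) \<longlonglongrightarrow> 0"
  shows "(\<lambda>n. \<Phi> (x n)) \<longlonglongrightarrow> \<Phi> z"
proof -
  obtain L where L: "\<And>u v. u \<in> lp p \<Longrightarrow> v \<in> lp p \<Longrightarrow> lp_norm p u \<le> lp_norm p z + 1 \<Longrightarrow>
      lp_norm p v \<le> lp_norm p z + 1 \<Longrightarrow> \<bar>\<Phi> u - \<Phi> v\<bar> \<le> L * lp_norm p (\<lambda>k. u k - v k)"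
    using potential_lipschitz[of "lp_norm p z + 1"] by blast
  have "\<forall>\<^sub>F n in sequentially. norm (\<Phi> (x n) - \<Phi> z) \<le> L * lp_norm p (\<lambda>k. x n k - z k)"
    using eventually_lp_norm_less[OF x z lim]
  proof eventually_elim
    case (elim n)
    then show ?case using L[OF x z, of n] by simp
  qed
  moreover have "(\<lambda>n. L * lp_norm p (\<lambda>k. x n k - z k)) \<longlonglongrightarrow> 0"
    using tendsto_mult[OF tendsto_const[of L] lim] by simp
  ultimately have "(\<lambda>n. \<Phi> (x n) - \<Phi> z) \<longlonglongrightarrow> 0"
    by (rule Lim_null_comparison)
  then show ?thesis by (simp add: LIM_zero_iff)
qed

section \<open>Measurability of the potential and posterior masses\<close>

lemma sets_gauss_seq_borel: "sets \<nu> = sets borel"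
  using sets_PiM_equal_borel sets_gauss_seq by metis

text \<open>\<Phi> is known to be continuous in norm only, but after \<open>trunc n\<close> it
  depends on finitely many coordinates and is continuous in the product topology, whose Borel sets
  form the product sigma-algebra. Letting \<open>n\<close> grow makes \<Phi> itself measurable on
  \<open>lp p\<close>.\<close>

lemma potential_trunc_measurable [measurable]: "(\<lambda>u. \<Phi> (trunc n u)) \<in> borel_measurable \<nu>"
proof -
  have "continuous_on UNIV (\<lambda>u. \<Phi> (trunc n u))"
  proof (rule continuous_on_sequentiallyI)
    fix v :: "nat \<Rightarrow> nat \<Rightarrow> real" and u assume v: "v \<longlonglongrightarrow> u"
    have "(\<lambda>i. v i k) \<longlonglongrightarrow> u k" for k
      using continuous_on_tendsto_compose[OF continuous_on_product_coordinates[of k] v] by simp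
    then have "(\<lambda>i. \<bar>v i k - u k\<bar>) \<longlonglongrightarrow> 0" for k
      by (intro tendsto_rabs_zero) (simp add: LIM_zero_iff)
    then have "(\<lambda>i. \<bar>v i k - u k\<bar> powr p) \<longlonglongrightarrow> 0" for k
      by (rule tendsto_zero_powrI[OF _ tendsto_const]) (use p_pos in auto)
    then have "(\<lambda>i. \<Sum>k<n. \<bar>v i k - u k\<bar> powr p) \<longlonglongrightarrow> 0"
      by (intro tendsto_null_sum)
    then have "(\<lambda>i. (\<Sum>k<n. \<bar>v i k - u k\<bar> powr p) powr (1 / p)) \<longlonglongrightarrow> 0"
      by (rule tendsto_zero_powrI[OF _ tendsto_const]) (use p_pos in \<open>auto intro!: always_eventually sum_nonneg\<close>)
    moreover have "lp_norm p (\<lambda>k. trunc n (v i) k - trunc n u k) = (\<Sum>k<n. \<bar>v i k - u k\<bar> powr p) powr (1 / p)" for i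
      by (subst lp_norm_finite_support[of n]) (auto simp: trunc_def)
    ultimately show "(\<lambda>i. \<Phi> (trunc n (v i))) \<longlonglongrightarrow> \<Phi> (trunc n u)"
      by (intro potential_tendsto lp_trunc) simp
  qed
  then have "(\<lambda>u. \<Phi> (trunc n u)) \<in> borel_measurable borel"
    by (rule borel_measurable_continuous_onI)
  then show ?thesis
    using measurable_cong_sets[OF sets_gauss_seq_borel refl] by blast
qed

lemma sets_gauss_lp: "A \<in> sets \<nu> \<Longrightarrow> A \<subseteq> lp p \<Longrightarrow> A \<in> sets \<mu>"
  unfolding gauss_lp_def by (subst sets_restrict_space_iff) auto

lemma emeasure_gauss_lp: "A \<subseteq> lp p \<Longrightarrow> emeasure \<mu> A = emeasure \<nu> A"
  unfolding gauss_lp_def by (intro emeasure_restrict_space) auto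

lemma space_gauss_lp [simp]: "space \<mu> = lp p"
  by (simp add: gauss_lp_def space_restrict_space)

lemma prob_space_gauss_lp: "prob_space \<mu>"
  by (rule prob_spaceI) (use prob_lp in \<open>simp add: emeasure_gauss_lp emeasure_eq_measure\<close>)

lemma potential_measurable [measurable]: "\<Phi> \<in> borel_measurable \<mu>"
proof -
  have "(\<lambda>u. if u \<in> lp p then \<Phi> u else 0) \<in> borel_measurable \<nu>"
  proof (rule borel_measurable_LIMSEQ_real)
    show "(\<lambda>n. if u \<in> lp p then \<Phi> (trunc n u) else 0) \<longlonglongrightarrow> (if u \<in> lp p then \<Phi> u else 0)" for u
      using potential_tendsto[OF lp_trunc, of u "\<lambda>n. n" "\<lambda>n. u"] lp_norm_trunc_tendsto[of u] by simp
  qed measurable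
  then show ?thesis
    unfolding gauss_lp_def by (subst measurable_restrict_space_iff[where c = 0]) auto
qed

lemma exp_potential_integrable: "integrable \<mu> (\<lambda>u. exp (- \<Phi> u))"
proof -
  interpret \<mu>: prob_space \<mu> by (rule prob_space_gauss_lp)
  obtain M where "\<And>u. u \<in> lp p \<Longrightarrow> M \<le> \<Phi> u" using potential_bounded_below by blast
  then show ?thesis
    by (intro \<mu>.integrable_const_bound[of _ "exp (- M)"]) auto
qed

lemma Z_pos: "0 < Z"
proof -
  interpret \<mu>: prob_space \<mu> by (rule prob_space_gauss_lp)
  have "Z \<noteq> 0"
  proof
    assume "Z = 0"
    then have "AE u in \<mu>. exp (- \<Phi> u) = 0"
      unfolding Z_def by (subst (asm) integral_nonneg_eq_0_iff_AE) (auto simp: exp_potential_integrable)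
    then have "AE u in \<mu>. False" by simp
    then show False using \<mu>.AE_False by blast
  qed
  moreover have "0 \<le> Z" unfolding Z_def by (rule Bochner_Integration.integral_nonneg) simp
  ultimately show ?thesis by simp
qed

lemma emeasure_posterior:
  assumes "A \<in> sets \<nu>" "A \<subseteq> lp p"
  shows "emeasure (posterior \<mu> \<Phi>) A = (\<integral>\<^sup>+u. ennreal (exp (- \<Phi> u) / Z) * indicator A u \<partial>\<mu>)"
  unfolding posterior_def Z_def
  by (rule emeasure_density) (use assms sets_gauss_lp in measurable)

lemma emeasure_posterior_le:
  assumes A: "A \<in> sets \<nu>" "A \<subseteq> lp p" and a: "\<And>u. u \<in> A \<Longrightarrow> a \<le> \<Phi> u"
  shows "emeasure (posterior \<mu> \<Phi>) A \<le> ennreal (exp (- a) / Z * prob A)"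
proof -
  have "emeasure (posterior \<mu> \<Phi>) A \<le> (\<integral>\<^sup>+u. ennreal (exp (- a) / Z) * indicator A u \<partial>\<mu>)"
    unfolding emeasure_posterior[OF A] using a Z_pos
    by (intro nn_integral_mono) (auto simp: indicator_def intro!: ennreal_leI divide_right_mono)
  also have "\<dots> = ennreal (exp (- a) / Z) * emeasure \<mu> A"
    by (rule nn_integral_cmult_indicator) (rule sets_gauss_lp[OF A])
  also have "\<dots> = ennreal (exp (- a) / Z * prob A)"
    using Z_pos by (simp add: emeasure_gauss_lp[OF A(2)] emeasure_eq_measure ennreal_mult[symmetric])
  finally show ?thesis .
qed

lemma measure_posterior_le:
  assumes "A \<in> sets \<nu>" "A \<subseteq> lp p" and "\<And>u. u \<in> A \<Longrightarrow> a \<le> \<Phi> u"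
  shows "Z * measure (posterior \<mu> \<Phi>) A \<le> exp (- a) * prob A"
proof -
  have "measure (posterior \<mu> \<Phi>) A \<le> exp (- a) / Z * prob A"
    unfolding measure_def[of "posterior \<mu> \<Phi>"]
    by (rule enn2real_leI[OF _ emeasure_posterior_le[OF assms]]) (use Z_pos in auto)
  then show ?thesis using Z_pos by (simp add: field_simps)
qed

lemma measure_posterior_ge:
  assumes A: "A \<in> sets \<nu>" "A \<subseteq> lp p" and b: "\<And>u. u \<in> A \<Longrightarrow> \<Phi> u \<le> b"
  shows "exp (- b) * prob A \<le> Z * measure (posterior \<mu> \<Phi>) A"
proof -
  obtain M where "\<And>u. u \<in> A \<Longrightarrow> M \<le> \<Phi> u" using potential_bounded_below A(2) by blast
  \<comment> \<open>\<open>measure\<close> returns 0 on sets of infinite mass, so a lower bound for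
    it requires finiteness; this comes from the lower bound of \<Phi>.\<close>
  then have fin: "emeasure (posterior \<mu> \<Phi>) A \<noteq> \<top>"
    using emeasure_posterior_le[OF A, of M] by (auto simp: top_unique)
  have "ennreal (exp (- b) / Z * prob A) = ennreal (exp (- b) / Z) * emeasure \<mu> A"
    using Z_pos by (simp add: emeasure_gauss_lp[OF A(2)] emeasure_eq_measure ennreal_mult[symmetric])
  also have "\<dots> = (\<integral>\<^sup>+u. ennreal (exp (- b) / Z) * indicator A u \<partial>\<mu>)"
    by (rule nn_integral_cmult_indicator[symmetric]) (rule sets_gauss_lp[OF A])
  also have "\<dots> \<le> emeasure (posterior \<mu> \<Phi>) A"
    unfolding emeasure_posterior[OF A] using b Z_pos
    by (intro nn_integral_mono) (auto simp: indicator_def intro!: ennreal_leI divide_right_mono)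
  also have "\<dots> = ennreal (measure (posterior \<mu> \<Phi>) A)"
    using fin by (rule emeasure_eq_ennreal_measure)
  finally have "exp (- b) / Z * prob A \<le> measure (posterior \<mu> \<Phi>) A"
    by (simp add: ennreal_le_iff)
  then show ?thesis using Z_pos by (simp add: field_simps)
qed

lemma lp_ball_subset_lp: "lp_ball p \<delta> x \<subseteq> lp p"
  by (auto simp: lp_ball_def)

lemma mass_le: "x \<in> lp p \<Longrightarrow> (\<And>u. u \<in> lp_ball p \<delta> x \<Longrightarrow> a \<le> \<Phi> u) \<Longrightarrow> Z * mass \<delta> x \<le> exp (- a) * prob (lp_ball p \<delta> x)"
  by (intro measure_posterior_le lp_ball_measurable lp_ball_subset_lp)

lemma mass_ge: "x \<in> lp p \<Longrightarrow> (\<And>u. u \<in> lp_ball p \<delta> x \<Longrightarrow> \<Phi> u \<le> b) \<Longrightarrow> exp (- b) * prob (lp_ball p \<delta> x) \<le> Z * mass \<delta> x"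
  by (intro measure_posterior_ge lp_ball_measurable lp_ball_subset_lp)

text \<open>Within the ball, \<Phi> differs from its value at the centre by at most
  \<open>L * \<delta>\<close>. The restriction \<open>\<delta> \<le> 1\<close> keeps the ball within
  norm \<open>R + 1\<close>, so one Lipschitz constant serves all centres.\<close>

lemma mass_local_bounds:
  "\<exists>L. \<forall>x\<in>lp p. \<forall>\<delta>. lp_norm p x \<le> R \<longrightarrow> 0 < \<delta> \<longrightarrow> \<delta> \<le> 1 \<longrightarrow>
    exp (- \<Phi> x - L * \<delta>) * prob (lp_ball p \<delta> x) \<le> Z * mass \<delta> x \<and>
    Z * mass \<delta> x \<le> exp (- \<Phi> x + L * \<delta>) * prob (lp_ball p \<delta> x)"
proof -
  obtain L where "0 < L" and L: "\<And>u v. u \<in> lp p \<Longrightarrow> v \<in> lp p \<Longrightarrow> lp_norm p u \<le> R + 1 \<Longrightarrow>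
      lp_norm p v \<le> R + 1 \<Longrightarrow> \<bar>\<Phi> u - \<Phi> v\<bar> \<le> L * lp_norm p (\<lambda>k. u k - v k)"
    using potential_lipschitz[of "R + 1"] by blast
  have "\<Phi> x - L * \<delta> \<le> \<Phi> u \<and> \<Phi> u \<le> \<Phi> x + L * \<delta>"
    if x: "x \<in> lp p" "lp_norm p x \<le> R" and \<delta>: "0 < \<delta>" "\<delta> \<le> 1" and u: "u \<in> lp_ball p \<delta> x" for x u \<delta>
  proof -
    have u: "u \<in> lp p" "lp_norm p (\<lambda>k. u k - x k) < \<delta>" using u by (auto simp: lp_ball_def)
    have "lp_norm p u \<le> R + 1"
      using lp_norm_triangle_sub[OF u(1) x(1)] u(2) x(2) \<delta> by linarith
    then have "\<bar>\<Phi> u - \<Phi> x\<bar> \<le> L * lp_norm p (\<lambda>k. u k - x k)"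
      using x u by (intro L) auto
    also have "\<dots> \<le> L * \<delta>" using u \<open>0 < L\<close> by (intro mult_left_mono) auto
    finally show ?thesis by linarith
  qed
  then have "exp (- (\<Phi> x + L * \<delta>)) * prob (lp_ball p \<delta> x) \<le> Z * mass \<delta> x \<and>
      Z * mass \<delta> x \<le> exp (- (\<Phi> x - L * \<delta>)) * prob (lp_ball p \<delta> x)"
    if "x \<in> lp p" "lp_norm p x \<le> R" "0 < \<delta>" "\<delta> \<le> 1" for x \<delta>
    using that by (intro conjI mass_ge mass_le) auto
  then show ?thesis
    by (intro exI[of _ L]) simp
qed

text \<open>The centre may have infinite energy, so positivity is taken from a ball of half the
  radius about a truncation. It makes \<open>sup_mass\<close> positive and the ratios
  meaningful.\<close>

lemma mass_pos:
  assumes x: "x \<in> lp p" and \<delta>: "0 < \<delta>"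
  shows "0 < mass \<delta> x"
proof -
  have "\<forall>\<^sub>F n in sequentially. lp_norm p (\<lambda>k. trunc n x k - x k) < \<delta> / 2"
    using \<delta> by (intro order_tendstoD(2)[OF lp_norm_trunc_tendsto[OF x]]) auto
  then obtain n where n: "lp_norm p (\<lambda>k. trunc n x k - x k) < \<delta> / 2"
    by (auto simp: eventually_sequentially)
  have "0 < exp (- energy n (trunc n x) / 2) * centred (\<delta> / 2)"
    using \<delta> by (intro mult_pos_pos prob_lp_ball_pos) auto
  also have "\<dots> \<le> prob (lp_ball p (\<delta> / 2) (trunc n x))"
    by (rule prob_lp_ball_finite_support_ge) (simp add: trunc_def)
  also have "\<dots> \<le> prob (lp_ball p \<delta> x)"
    using n x by (intro finite_measure_mono lp_ball_subset lp_ball_measurable) auto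
  finally have pos: "0 < prob (lp_ball p \<delta> x)" .
  obtain K where K: "\<And>u. u \<in> lp p \<Longrightarrow> lp_norm p u < lp_norm p x + \<delta> \<Longrightarrow> \<Phi> u \<le> K"
    using potential_bounded_above by blast
  have "exp (- K) * prob (lp_ball p \<delta> x) \<le> Z * mass \<delta> x"
  proof (rule mass_ge[OF x])
    fix u assume "u \<in> lp_ball p \<delta> x"
    then have u: "u \<in> lp p" "lp_norm p (\<lambda>k. u k - x k) < \<delta>" by (auto simp: lp_ball_def)
    with lp_norm_triangle_sub[OF u(1) x] show "\<Phi> u \<le> K" by (intro K) auto
  qed
  moreover have "0 < exp (- K) * prob (lp_ball p \<delta> x)" using pos by simp
  ultimately have "0 < Z * mass \<delta> x" by linarith
  then show ?thesis using Z_pos by (simp add: zero_less_mult_iff)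
qed

lemma mass_bdd_above: "bdd_above (mass \<delta> ` lp p)"
proof -
  obtain M where M: "\<And>u. u \<in> lp p \<Longrightarrow> M \<le> \<Phi> u" using potential_bounded_below by blast
  have "mass \<delta> x \<le> exp (- M) / Z" if "x \<in> lp p" for x
  proof -
    have "Z * mass \<delta> x \<le> exp (- M) * prob (lp_ball p \<delta> x)"
      using that by (intro mass_le M) (auto simp: lp_ball_def)
    also have "\<dots> \<le> exp (- M) * 1" by (intro mult_left_mono) auto
    finally show ?thesis using Z_pos by (simp add: field_simps)
  qed
  then show ?thesis by (rule bdd_aboveI2)
qed

section \<open>The supremum of ball masses and limits of near-maximisers\<close>

abbreviation sup_mass :: "real \<Rightarrow> real" where
  "sup_mass \<delta> \<equiv> (SUP x\<in>lp p. mass \<delta> x)"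

lemma mass_le_sup: "x \<in> lp p \<Longrightarrow> mass \<delta> x \<le> sup_mass \<delta>"
  by (rule cSUP_upper[OF _ mass_bdd_above])

lemma sup_mass_pos: "0 < \<delta> \<Longrightarrow> 0 < sup_mass \<delta>"
  using mass_pos[OF lp_zero] mass_le_sup[OF lp_zero] by (rule less_le_trans)

lemma ball_ratio_eq: "ball_ratio p (posterior \<mu> \<Phi>) \<delta> x = mass \<delta> x / sup_mass \<delta>"
  by (simp add: ball_ratio_def)

lemma near_maximizer:
  assumes "0 < \<delta>" "0 < e"
  shows "\<exists>x\<in>lp p. (1 - e) * sup_mass \<delta> \<le> mass \<delta> x"
proof -
  have "(1 - e) * sup_mass \<delta> < sup_mass \<delta>"
    using sup_mass_pos[OF assms(1)] assms(2) by (simp add: algebra_simps)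
  then obtain x where "x \<in> lp p" "(1 - e) * sup_mass \<delta> < mass \<delta> x"
    using less_cSUP_iff[OF _ mass_bdd_above, of "(1 - e) * sup_mass \<delta>" \<delta>] lp_zero by blast
  then show ?thesis by (auto intro: less_imp_le)
qed

lemma mass_ge_onsager_machlup:
  assumes h: "h \<in> cm_space p \<mu>"
  shows "\<exists>L. \<forall>\<delta>. 0 < \<delta> \<longrightarrow> \<delta> \<le> 1 \<longrightarrow> exp (- OM h - L * \<delta>) * centred \<delta> \<le> Z * mass \<delta> h"
proof -
  have hlp: "h \<in> lp p" using h by (simp add: cm_space_iff)
  obtain L where L: "\<And>\<delta>. 0 < \<delta> \<Longrightarrow> \<delta> \<le> 1 \<Longrightarrow> exp (- \<Phi> h - L * \<delta>) * prob (lp_ball p \<delta> h) \<le> Z * mass \<delta> h"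
    using mass_local_bounds[of "lp_norm p h"] hlp by blast
  have "exp (- OM h - L * \<delta>) * centred \<delta> \<le> Z * mass \<delta> h" if "0 < \<delta>" "\<delta> \<le> 1" for \<delta>
  proof -
    have "exp (- OM h - L * \<delta>) * centred \<delta> = exp (- \<Phi> h - L * \<delta>) * (exp (- (cm_norm p \<mu> h)\<^sup>2 / 2) * centred \<delta>)"
      by (simp add: onsager_machlup_def exp_add[symmetric] mult.assoc[symmetric])
    also have "\<dots> \<le> exp (- \<Phi> h - L * \<delta>) * prob (lp_ball p \<delta> h)"
      using hlp h that by (intro mult_left_mono prob_lp_ball_ge_energy energy_le_cm_norm) auto
    also have "\<dots> \<le> Z * mass \<delta> h" using that by (rule L)
    finally show ?thesis .
  qed
  then show ?thesis by blast
qed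

text \<open>Large masses force, through the explicit Anderson inequality, bounded energy of nearby
  points, and compactness supplies \<open>z\<close>. The sequence \<open>b\<close> admits errors
  that vanish in the limit. The value \<open>c\<close> is free: it is used both as
  \<open>exp (- OM h)\<close> for a competitor \<open>h\<close> and as a number strictly above
  \<open>exp (- OM z)\<close> for a supposed minimiser \<open>z\<close>.\<close>

lemma large_mass_compact:
  assumes d: "\<And>n. 0 < d n" "d \<longlonglongrightarrow> 0" and x: "\<And>n. x n \<in> lp p"
    and c: "b \<longlonglongrightarrow> c" "0 < c"
    and large: "\<forall>\<^sub>F n in sequentially. b n * centred (d n) \<le> Z * mass (d n) (x n)"
  obtains z r where "strict_mono (r :: nat \<Rightarrow> nat)" "z \<in> cm_space p \<mu>"
    "(\<lambda>n. lp_norm p (\<lambda>k. x (r n) k - z k)) \<longlonglongrightarrow> 0" "c \<le> exp (- OM z)"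
proof -
  obtain M where M: "\<And>u. u \<in> lp p \<Longrightarrow> M \<le> \<Phi> u" using potential_bounded_below by blast
  have g: "0 < centred (d n)" for n by (rule prob_lp_ball_pos[OF d(1)])
  \<comment> \<open>The number of coordinates behind the minimiser varies with \<open>n\<close>.
    Weakening the exponent to \<open>energy m h\<close> for every \<open>m\<close> allows a limit in
    \<open>n\<close> with \<open>m\<close> fixed.\<close>
  have "\<exists>h. h \<in> lp p \<and> lp_norm p (\<lambda>k. h k - x n k) \<le> 2 * d n \<and>
      (\<forall>m. prob (lp_ball p (d n) (x n)) \<le> exp (- energy m h / 2) * centred (d n))" for n
  proof -
    obtain h N where h: "h \<in> lp p" "\<And>m. energy m h \<le> energy N h" "lp_norm p (\<lambda>k. h k - x n k) \<le> 2 * d n"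
      and le: "prob (lp_ball p (d n) (x n)) \<le> exp (- energy N h / 2) * centred (d n)"
      by (rule prob_lp_ball_le_energy[OF x[of n] d(1)[of n]]) blast
    have "prob (lp_ball p (d n) (x n)) \<le> exp (- energy m h / 2) * centred (d n)" for m
      using h(2)[of m] by (intro order_trans[OF le] mult_right_mono) auto
    with h show ?thesis by blast
  qed
  then obtain h where h: "\<And>n. h n \<in> lp p" "\<And>n. lp_norm p (\<lambda>k. h n k - x n k) \<le> 2 * d n"
    and hle: "\<And>n m. prob (lp_ball p (d n) (x n)) \<le> exp (- energy m (h n) / 2) * centred (d n)"
    by metis
  have "\<forall>\<^sub>F n in sequentially. c / 2 < b n" "\<forall>\<^sub>F n in sequentially. d n < 1"
    using order_tendstoD(1)[OF c(1), of "c / 2"] order_tendstoD(2)[OF d(2), of 1] c(2) by auto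
  with large have "\<forall>\<^sub>F n in sequentially. c / 2 < b n \<and> d n < 1 \<and> b n * centred (d n) \<le> Z * mass (d n) (x n)"
    by eventually_elim auto
  then obtain n0 where n0: "\<And>n. n0 \<le> n \<Longrightarrow> c / 2 < b n" "\<And>n. n0 \<le> n \<Longrightarrow> d n < 1"
      "\<And>n. n0 \<le> n \<Longrightarrow> b n * centred (d n) \<le> Z * mass (d n) (x n)"
    by (auto simp: eventually_sequentially)
  \<comment> \<open>Only the global bound \<open>M\<close> is available while the centres may be
    unbounded. The constant results from taking logarithms in
    \<open>c / 2 \<le> exp (- M - energy m (h ?n) / 2)\<close>.\<close>
  have en: "energy m (h (i + n0)) \<le> 2 * (- M - ln (c / 2))" for i m
  proof -
    let ?n = "i + n0"
    have "c / 2 * centred (d ?n) \<le> b ?n * centred (d ?n)"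
      using n0(1)[of ?n] g by (intro mult_right_mono) auto
    also have "\<dots> \<le> Z * mass (d ?n) (x ?n)" by (rule n0) simp
    also have "\<dots> \<le> exp (- M) * prob (lp_ball p (d ?n) (x ?n))"
      by (intro mass_le M x) (auto simp: lp_ball_def)
    also have "\<dots> \<le> exp (- M) * (exp (- energy m (h ?n) / 2) * centred (d ?n))"
      by (intro mult_left_mono hle) auto
    finally have "c / 2 \<le> exp (- M - energy m (h ?n) / 2)"
      using g[of ?n] by (simp add: mult.assoc[symmetric] exp_add[symmetric])
    then have "ln (c / 2) \<le> - M - energy m (h ?n) / 2"
      using c(2) by (subst (asm) ln_le_cancel_iff[symmetric]) auto
    moreover have "e \<le> 2 * (a - l)" if "l \<le> a - e / 2" for a e l :: real
      using that by simp
    ultimately show ?thesis by blast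
  qed
  obtain z r0 where r0: "strict_mono (r0 :: nat \<Rightarrow> nat)" and z: "z \<in> lp p"
    and hz: "(\<lambda>i. lp_norm p (\<lambda>k. h (r0 i + n0) k - z k)) \<longlonglongrightarrow> 0"
    by (rule energy_bounded_compact[of "\<lambda>i. h (i + n0)", OF en])
  define r where "r i = r0 i + n0" for i
  have r: "strict_mono r" using r0 by (auto simp: r_def strict_mono_def)
  have dr: "(\<lambda>i. d (r i)) \<longlonglongrightarrow> 0"
    using LIMSEQ_subseq_LIMSEQ[OF d(2) r] by (simp add: o_def)
  have xz: "(\<lambda>i. lp_norm p (\<lambda>k. x (r i) k - z k)) \<longlonglongrightarrow> 0"
  proof (rule Lim_null_comparison)
    have "lp_norm p (\<lambda>k. x (r i) k - z k) \<le> 2 * d (r i) + lp_norm p (\<lambda>k. h (r i) k - z k)" for i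
      using lp_norm_triangle[OF x h(1) z, of "r i" "r i"] h(2)[of "r i"]
        lp_norm_minus[of "h (r i)" "x (r i)"] by linarith
    then show "\<forall>\<^sub>F i in sequentially. norm (lp_norm p (\<lambda>k. x (r i) k - z k)) \<le> 2 * d (r i) + lp_norm p (\<lambda>k. h (r i) k - z k)"
      by simp
    show "(\<lambda>i. 2 * d (r i) + lp_norm p (\<lambda>k. h (r i) k - z k)) \<longlonglongrightarrow> 0"
      using tendsto_add[OF tendsto_mult[OF tendsto_const[of 2] dr] hz] by (simp add: r_def)
  qed
  \<comment> \<open>Along the subsequence the centres eventually have norm below
    \<open>lp_norm p z + 1\<close>, so one Lipschitz constant can now replace the crude bound
    \<open>M\<close>.\<close>
  obtain L where L: "\<And>y \<delta>. y \<in> lp p \<Longrightarrow> lp_norm p y \<le> lp_norm p z + 1 \<Longrightarrow> 0 < \<delta> \<Longrightarrow> \<delta> \<le> 1 \<Longrightarrow>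
      Z * mass \<delta> y \<le> exp (- \<Phi> y + L * \<delta>) * prob (lp_ball p \<delta> y)"
    using mass_local_bounds[of "lp_norm p z + 1"] by blast
  \<comment> \<open>Lower semicontinuity of the energy: \<open>m\<close> stays fixed while
    \<open>i\<close> grows, and the supremum over \<open>m\<close> is taken afterwards by
    \<open>cm_norm_le\<close>.\<close>
  have le: "c \<le> exp (- \<Phi> z - energy m z / 2)" for m
  proof (rule tendsto_le[OF sequentially_bot])
    show "(\<lambda>i. b (r i)) \<longlonglongrightarrow> c"
      using LIMSEQ_subseq_LIMSEQ[OF c(1) r] by (simp add: o_def)
    have hk: "(\<lambda>i. h (r i) k) \<longlonglongrightarrow> z k" for k
    proof -
      have "(\<lambda>i. h (r i) k - z k) \<longlonglongrightarrow> 0"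
      proof (rule Lim_null_comparison[OF _ hz])
        show "\<forall>\<^sub>F i in sequentially. norm (h (r i) k - z k) \<le> lp_norm p (\<lambda>k. h (r0 i + n0) k - z k)"
          using abs_le_lp_norm[OF lp_diff[OF h(1) z]] by (simp add: r_def)
      qed
      then show ?thesis by (simp add: LIM_zero_iff)
    qed
    have "(\<lambda>i. exp (- \<Phi> (x (r i)) + L * d (r i) - energy m (h (r i)) / 2)) \<longlonglongrightarrow> exp (- \<Phi> z + L * 0 - energy m z / 2)"
      using potential_tendsto[OF x z xz] energy_tendsto[OF hk, of m] dr by (intro tendsto_intros) auto
    then show "(\<lambda>i. exp (- \<Phi> (x (r i)) + L * d (r i) - energy m (h (r i)) / 2)) \<longlonglongrightarrow> exp (- \<Phi> z - energy m z / 2)"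
      by simp
    show "\<forall>\<^sub>F i in sequentially. b (r i) \<le> exp (- \<Phi> (x (r i)) + L * d (r i) - energy m (h (r i)) / 2)"
      using eventually_lp_norm_less[OF x z xz]
    proof eventually_elim
      case (elim i)
      have "n0 \<le> r i" by (simp add: r_def)
      then have "b (r i) * centred (d (r i)) \<le> Z * mass (d (r i)) (x (r i))" "d (r i) \<le> 1"
        using n0 by (auto intro: less_imp_le)
      moreover from this elim have "Z * mass (d (r i)) (x (r i)) \<le>
          exp (- \<Phi> (x (r i)) + L * d (r i)) * prob (lp_ball p (d (r i)) (x (r i)))"
        by (intro L x d) auto
      moreover have "\<dots> \<le> exp (- \<Phi> (x (r i)) + L * d (r i)) * (exp (- energy m (h (r i)) / 2) * centred (d (r i)))"
        by (intro mult_left_mono hle) auto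
      ultimately have "b (r i) * centred (d (r i)) \<le>
          exp (- \<Phi> (x (r i)) + L * d (r i)) * (exp (- energy m (h (r i)) / 2) * centred (d (r i)))"
        by linarith
      then show ?case
        using g[of "r i"] by (simp add: mult.assoc[symmetric] exp_add[symmetric])
    qed
  qed
  have energy: "energy m z \<le> 2 * (- \<Phi> z - ln c)" for m
  proof -
    have "ln c \<le> - \<Phi> z - energy m z / 2"
      using le[of m] c(2) by (subst (asm) ln_le_cancel_iff[symmetric]) auto
    moreover have "e \<le> 2 * (a - l)" if "l \<le> a - e / 2" for a e l :: real
      using that by simp
    ultimately show ?thesis by blast
  qed
  have "(cm_norm p \<mu> z)\<^sup>2 \<le> 2 * (- \<Phi> z - ln c)"
    by (rule cm_norm_le[OF z energy])
  then have "ln c \<le> - OM z" by (simp add: onsager_machlup_def)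
  then have "c \<le> exp (- OM z)" using c(2) by (metis exp_le_cancel_iff exp_ln)
  moreover have "z \<in> cm_space p \<mu>" using z energy by (auto simp: cm_space_iff)
  ultimately show thesis using r xz by (intro that[of r z])
qed

lemma lp_limit_unique:
  assumes x: "\<And>n. x n \<in> lp p" and "y \<in> lp p" "z \<in> lp p"
    and "(\<lambda>n. lp_norm p (\<lambda>k. x n k - y k)) \<longlonglongrightarrow> 0" "(\<lambda>n. lp_norm p (\<lambda>k. x n k - z k)) \<longlonglongrightarrow> 0"
  shows "y = z"
proof
  fix k
  have coord: "(\<lambda>n. x n k) \<longlonglongrightarrow> w k" if "w \<in> lp p" "(\<lambda>n. lp_norm p (\<lambda>k. x n k - w k)) \<longlonglongrightarrow> 0" for w
  proof -
    have "(\<lambda>n. x n k - w k) \<longlonglongrightarrow> 0"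
      by (rule Lim_null_comparison[OF _ that(2)]) (use abs_le_lp_norm[OF lp_diff[OF x that(1)]] in simp)
    then show ?thesis by (simp add: LIM_zero_iff)
  qed
  show "y k = z k"
    using coord[OF assms(2,4)] coord[OF assms(3,5)] by (rule LIMSEQ_unique)
qed

section \<open>Minimisers, MAP estimators and limit points\<close>

abbreviation OM_minimizer :: "(nat \<Rightarrow> real) \<Rightarrow> bool" where
  "OM_minimizer z \<equiv> z \<in> cm_space p \<mu> \<and> (\<forall>u\<in>cm_space p \<mu>. OM z \<le> OM u)"

lemma zero_cm_space: "(\<lambda>k. 0) \<in> cm_space p \<mu>"
  by (auto simp: cm_space_iff energy_def intro: exI[of _ 0])

text \<open>A near-maximiser carries at least \<open>1 - e n\<close> times the mass at any fixed
  competitor \<open>h\<close>. This factor tends to 1 and is absorbed into \<open>b\<close>,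
  together with the error \<open>exp (- L * d n)\<close>.\<close>

lemma near_maximizer_mass_ge:
  assumes d: "\<And>n. 0 < d n" "d \<longlonglongrightarrow> 0" and e: "e \<longlonglongrightarrow> 0" "\<And>n. e n < (1::real)"
    and near: "\<And>n. (1 - e n) * sup_mass (d n) \<le> mass (d n) (x n)"
    and h: "h \<in> cm_space p \<mu>"
  obtains b where "b \<longlonglongrightarrow> exp (- OM h)"
    "\<forall>\<^sub>F n in sequentially. b n * centred (d n) \<le> Z * mass (d n) (x n)"
proof -
  obtain L where L: "\<And>\<delta>. 0 < \<delta> \<Longrightarrow> \<delta> \<le> 1 \<Longrightarrow> exp (- OM h - L * \<delta>) * centred \<delta> \<le> Z * mass \<delta> h"
    using mass_ge_onsager_machlup[OF h] by blast
  define b where "b n = (1 - e n) * exp (- OM h - L * d n)" for n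
  have "b \<longlonglongrightarrow> (1 - 0) * exp (- OM h - L * 0)"
    unfolding b_def using d(2) e(1) by (intro tendsto_intros)
  then have "b \<longlonglongrightarrow> exp (- OM h)" by simp
  moreover have "\<forall>\<^sub>F n in sequentially. d n < 1"
    using d(2) by (rule order_tendstoD) simp
  then have "\<forall>\<^sub>F n in sequentially. b n * centred (d n) \<le> Z * mass (d n) (x n)"
  proof eventually_elim
    case (elim n)
    have "b n * centred (d n) = (1 - e n) * (exp (- OM h - L * d n) * centred (d n))"
      by (simp add: b_def)
    also have "\<dots> \<le> (1 - e n) * (Z * mass (d n) h)"
      using L[OF d(1), of n] elim e(2)[of n] by (intro mult_left_mono) auto
    also have "\<dots> \<le> (1 - e n) * (Z * sup_mass (d n))"
      using h e(2)[of n] Z_pos by (intro mult_left_mono mass_le_sup) (auto simp: cm_space_iff)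
    also have "\<dots> = Z * ((1 - e n) * sup_mass (d n))" by simp
    also have "\<dots> \<le> Z * mass (d n) (x n)"
      using near[of n] Z_pos by (intro mult_left_mono) auto
    finally show ?case .
  qed
  ultimately show thesis by (rule that)
qed

text \<open>Each competitor \<open>h\<close> yields a subsequential limit \<open>w\<close> with
  \<open>OM w \<le> OM h\<close>; as the whole sequence already converges to \<open>z\<close>, every
  such \<open>w\<close> equals \<open>z\<close>. The competitor 0 ensures that \<open>z\<close> lies
  in the Cameron-Martin space.\<close>

lemma near_maximizers_limit:
  assumes d: "\<And>n. 0 < d n" "d \<longlonglongrightarrow> 0" and e: "e \<longlonglongrightarrow> 0" "\<And>n. e n < (1::real)"
    and x: "\<And>n. x n \<in> lp p"
    and near: "\<And>n. (1 - e n) * sup_mass (d n) \<le> mass (d n) (x n)"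
    and z: "z \<in> lp p" and lim: "(\<lambda>n. lp_norm p (\<lambda>k. x n k - z k)) \<longlonglongrightarrow> 0"
  shows "OM_minimizer z"
proof -
  have *: "z \<in> cm_space p \<mu> \<and> OM z \<le> OM h" if h: "h \<in> cm_space p \<mu>" for h
  proof -
    obtain b where b: "b \<longlonglongrightarrow> exp (- OM h)"
      "\<forall>\<^sub>F n in sequentially. b n * centred (d n) \<le> Z * mass (d n) (x n)"
      by (rule near_maximizer_mass_ge[OF d e near h])
    obtain w r where r: "strict_mono r" and w: "w \<in> cm_space p \<mu>"
      and xw: "(\<lambda>n. lp_norm p (\<lambda>k. x (r n) k - w k)) \<longlonglongrightarrow> 0" and "exp (- OM h) \<le> exp (- OM w)"
      by (rule large_mass_compact[OF d x b(1) exp_gt_zero b(2)])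
    have "z = w"
      using LIMSEQ_subseq_LIMSEQ[OF lim r] z w xw
      by (intro lp_limit_unique[of "\<lambda>n. x (r n)"]) (auto simp: x o_def cm_space_iff)
    with w \<open>exp (- OM h) \<le> exp (- OM w)\<close> show ?thesis by simp
  qed
  then show ?thesis using zero_cm_space by blast
qed

text \<open>If the ratio were at most some \<open>a < 1\<close> along radii tending to 0,
  near-maximisers would outweigh \<open>z\<close> by a factor asymptotically at least
  \<open>1 / a\<close>, and a limit point \<open>w\<close> would satisfy
  \<open>OM w \<le> OM z + ln a < OM z\<close>.\<close>

lemma MAP_estimator_if_minimizer:
  assumes z: "OM_minimizer z"
  shows "MAP_estimator p (posterior \<mu> \<Phi>) z"
proof -
  have zcm: "z \<in> cm_space p \<mu>" and zlp: "z \<in> lp p" using z by (auto simp: cm_space_iff)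
  have "((\<lambda>\<delta>. ball_ratio p (posterior \<mu> \<Phi>) \<delta> z) \<longlongrightarrow> 1) (at_right 0)"
  proof (rule order_tendstoI)
    fix a :: real assume "1 < a"
    have "ball_ratio p (posterior \<mu> \<Phi>) \<delta> z \<le> 1" if "0 < \<delta>" for \<delta>
      using mass_le_sup[OF zlp] sup_mass_pos[OF that] by (simp add: ball_ratio_eq)
    then show "\<forall>\<^sub>F \<delta> in at_right 0. ball_ratio p (posterior \<mu> \<Phi>) \<delta> z < a"
      using \<open>1 < a\<close> unfolding eventually_at_right_field
      by (intro exI[of _ 1]) (auto intro: le_less_trans)
  next
    fix a' :: real assume a': "a' < 1"
    \<comment> \<open>Raising the threshold to at least 1/2 keeps \<open>a\<close> positive, so that
      dividing by it is possible.\<close>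
    define a where "a = max a' (1 / 2)"
    have a: "0 < a" "a < 1" "a' \<le> a" using a' by (auto simp: a_def)
    have "\<forall>\<^sub>F \<delta> in at_right 0. a < ball_ratio p (posterior \<mu> \<Phi>) \<delta> z"
    proof (rule ccontr)
      assume "\<not> ?thesis"
      then have "\<exists>\<delta>>0. \<delta> < b \<and> mass \<delta> z / sup_mass \<delta> \<le> a" if "0 < b" for b
        using that unfolding eventually_at_right_field ball_ratio_eq by (meson not_less)
      then have "\<forall>n. \<exists>\<delta>>0. \<delta> < inverse (real (Suc n)) \<and> mass \<delta> z / sup_mass \<delta> \<le> a"
        by (metis inverse_positive_iff_positive of_nat_0_less_iff zero_less_Suc)
      then obtain d where d: "\<And>n. 0 < d n" "\<And>n. d n < inverse (real (Suc n))"
        and ratio: "\<And>n. mass (d n) z / sup_mass (d n) \<le> a" by metis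
      have small: "mass (d n) z \<le> a * sup_mass (d n)" for n
        using ratio[of n] sup_mass_pos[OF d(1)[of n]] by (simp add: pos_divide_le_eq)
      have d0: "d \<longlonglongrightarrow> 0"
        by (rule tendsto_sandwich[OF _ _ tendsto_const LIMSEQ_inverse_real_of_nat])
          (use d in \<open>auto intro: always_eventually less_imp_le\<close>)
      define e where "e n = inverse (real (Suc (Suc n)))" for n
      have e: "e \<longlonglongrightarrow> 0" "\<And>n. 0 < e n" "\<And>n. e n < 1"
        unfolding e_def using LIMSEQ_Suc[OF LIMSEQ_inverse_real_of_nat] by (auto simp: inverse_less_1_iff)
      have "\<forall>n. \<exists>x\<in>lp p. (1 - e n) * sup_mass (d n) \<le> mass (d n) x"
        using near_maximizer d(1) e(2) by blast
      then obtain x where x: "\<And>n. x n \<in> lp p"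
        and near: "\<And>n. (1 - e n) * sup_mass (d n) \<le> mass (d n) (x n)" by metis
      obtain L where L: "\<And>\<delta>. 0 < \<delta> \<Longrightarrow> \<delta> \<le> 1 \<Longrightarrow> exp (- OM z - L * \<delta>) * centred \<delta> \<le> Z * mass \<delta> z"
        using mass_ge_onsager_machlup[OF zcm] by blast
      define b where "b n = (1 - e n) * exp (- OM z - L * d n) / a" for n
      have "b \<longlonglongrightarrow> (1 - 0) * exp (- OM z - L * 0) / a"
        unfolding b_def using d0 e(1) a by (intro tendsto_intros) auto
      then have b: "b \<longlonglongrightarrow> exp (- OM z) / a" by simp
      have "b n * centred (d n) \<le> Z * mass (d n) (x n)" for n
      proof -
        have "d n \<le> 1" using d(2)[of n] by (rule less_imp_le[OF less_le_trans]) (simp add: field_simps)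
        then have "exp (- OM z - L * d n) * centred (d n) \<le> Z * (a * sup_mass (d n))"
          using L[OF d(1), of n] small[of n] Z_pos by (meson mult_left_mono order_trans less_imp_le)
        then have "(1 - e n) / a * (exp (- OM z - L * d n) * centred (d n)) \<le> (1 - e n) / a * (Z * (a * sup_mass (d n)))"
          using e(3)[of n] a by (intro mult_left_mono) auto
        also have "\<dots> = Z * ((1 - e n) * sup_mass (d n))" using a by simp
        also have "\<dots> \<le> Z * mass (d n) (x n)"
          using near[of n] Z_pos by (intro mult_left_mono) auto
        finally show ?thesis by (simp add: b_def)
      qed
      then have large: "\<forall>\<^sub>F n in sequentially. b n * centred (d n) \<le> Z * mass (d n) (x n)"
        by simp
      have pos: "0 < exp (- OM z) / a" using a by simp
      obtain w r where "w \<in> cm_space p \<mu>" "exp (- OM z) / a \<le> exp (- OM w)"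
        by (rule large_mass_compact[OF d(1) d0 x b pos large])
      moreover have "exp (- OM z) < exp (- OM z) / a"
        using a by (simp add: less_divide_eq)
      ultimately have w: "w \<in> cm_space p \<mu>" and "exp (- OM z) < exp (- OM w)" by linarith+
      then have "OM w < OM z" by simp
      with z w show False by (auto simp: not_le[symmetric])
    qed
    then show "\<forall>\<^sub>F \<delta> in at_right 0. a' < ball_ratio p (posterior \<mu> \<Phi>) \<delta> z"
      by eventually_elim (use a in linarith)
  qed
  with zlp show ?thesis by (simp add: MAP_estimator_def)
qed

lemma minimizer_if_limit_point:
  assumes "asymptotic_maximizing_family p (posterior \<mu> \<Phi>) \<zeta>" "strong_limit_point p \<zeta> z"
  shows "OM_minimizer z"
proof -
  obtain e where e: "\<And>\<delta>. 0 < \<delta> \<Longrightarrow> e \<delta> < 1" "(e \<longlongrightarrow> 0) (at_right 0)"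
    and \<zeta>: "\<And>\<delta>. 0 < \<delta> \<Longrightarrow> \<zeta> \<delta> \<in> lp p"
    and near: "\<And>\<delta>. 0 < \<delta> \<Longrightarrow> 1 - e \<delta> < mass \<delta> (\<zeta> \<delta>) / sup_mass \<delta>"
    using assms(1) by (auto simp: asymptotic_maximizing_family_def ball_ratio_eq)
  obtain d where d: "\<And>n. 0 < d n" "d \<longlonglongrightarrow> 0" and z: "z \<in> lp p"
    and lim: "(\<lambda>n. lp_norm p (\<lambda>k. \<zeta> (d n) k - z k)) \<longlonglongrightarrow> 0"
    using assms(2) by (auto simp: strong_limit_point_def)
  have "d n \<in> {0<..} \<and> d n \<noteq> 0" for n using d(1)[of n] by auto
  then have "filterlim d (at_right 0) sequentially"
    unfolding filterlim_at using d(2) by simp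
  then have "(\<lambda>n. e (d n)) \<longlonglongrightarrow> 0" by (rule filterlim_compose[OF e(2)])
  moreover have "(1 - e (d n)) * sup_mass (d n) \<le> mass (d n) (\<zeta> (d n))" for n
    using near[OF d(1)[of n]] sup_mass_pos[OF d(1)[of n]] by (simp add: pos_less_divide_eq)
  ultimately show ?thesis
    using d e(1) \<zeta> z lim by (intro near_maximizers_limit[of d "\<lambda>n. e (d n)" "\<lambda>n. \<zeta> (d n)"]) auto
qed

lemma limit_point_if_MAP_estimator:
  assumes z: "MAP_estimator p (posterior \<mu> \<Phi>) z"
  shows "\<exists>\<zeta>. asymptotic_maximizing_family p (posterior \<mu> \<Phi>) \<zeta> \<and> strong_limit_point p \<zeta> z"
proof (intro exI conjI)
  let ?\<rho> = "\<lambda>\<delta>. ball_ratio p (posterior \<mu> \<Phi>) \<delta> z"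
  have zlp: "z \<in> lp p" and lim: "(?\<rho> \<longlongrightarrow> 1) (at_right 0)"
    using z by (auto simp: MAP_estimator_def)
  have \<rho>: "0 < ?\<rho> \<delta>" "?\<rho> \<delta> \<le> 1" if "0 < \<delta>" for \<delta>
    using mass_pos[OF zlp that] mass_le_sup[OF zlp] sup_mass_pos[OF that] by (auto simp: ball_ratio_eq)
  \<comment> \<open>The constant family \<open>z\<close> serves. Division by
    \<open>1 + \<delta>\<close> makes both \<open>0 < e \<delta>\<close> and
    \<open>1 - e \<delta> < ?\<rho> \<delta>\<close> strict even where the ratio equals 1, and still
    lets \<open>e\<close> tend to 0.\<close>
  define e where "e \<delta> = 1 - ?\<rho> \<delta> / (1 + \<delta>)" for \<delta>
  have "0 < e \<delta> \<and> e \<delta> < 1 \<and> 1 - e \<delta> < ?\<rho> \<delta>" if "0 < \<delta>" for \<delta>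
    using \<rho>[OF that] that by (auto simp: e_def divide_less_eq algebra_simps)
  moreover have "(e \<longlongrightarrow> 1 - 1 / (1 + 0)) (at_right 0)"
    unfolding e_def by (intro tendsto_intros lim) auto
  ultimately show "asymptotic_maximizing_family p (posterior \<mu> \<Phi>) (\<lambda>\<delta>. z)"
    unfolding asymptotic_maximizing_family_def using zlp by (intro conjI exI[of _ e]) auto
  have "decseq (\<lambda>n. inverse (real (Suc n)))"
    by (auto simp: decseq_def field_simps)
  then show "strong_limit_point p (\<lambda>\<delta>. z) z"
    unfolding strong_limit_point_def using zlp LIMSEQ_inverse_real_of_nat
    by (intro conjI exI[of _ "\<lambda>n. inverse (real (Suc n))"]) auto
qed

text \<open>Existence is drawn from the ball masses: comparing near-maximisers with the competitor 0
  gives a convergent subsequence, and its limit is a minimiser.\<close>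

lemma minimizer_exists: "\<exists>z. OM_minimizer z"
proof -
  \<comment> \<open>\<open>d\<close> is both radius and tolerance; the double successor keeps it
    strictly below 1 also at \<open>n = 0\<close>.\<close>
  define d where "d n = inverse (real (Suc (Suc n)))" for n
  have d: "d \<longlonglongrightarrow> 0" "\<And>n. 0 < d n" "\<And>n. d n < 1"
    unfolding d_def using LIMSEQ_Suc[OF LIMSEQ_inverse_real_of_nat] by (auto simp: inverse_less_1_iff)
  have "\<forall>n. \<exists>x\<in>lp p. (1 - d n) * sup_mass (d n) \<le> mass (d n) x"
    using near_maximizer d(2) by blast
  then obtain x where x: "\<And>n. x n \<in> lp p"
    and near: "\<And>n. (1 - d n) * sup_mass (d n) \<le> mass (d n) (x n)" by metis
  obtain b where b: "b \<longlonglongrightarrow> exp (- OM (\<lambda>k. 0))"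
      "\<forall>\<^sub>F n in sequentially. b n * centred (d n) \<le> Z * mass (d n) (x n)"
    by (rule near_maximizer_mass_ge[OF d(2,1) d(1,3) near zero_cm_space])
  obtain z r where r: "strict_mono r" and z: "z \<in> cm_space p \<mu>"
    and lim: "(\<lambda>n. lp_norm p (\<lambda>k. x (r n) k - z k)) \<longlonglongrightarrow> 0"
    by (rule large_mass_compact[OF d(2,1) x b(1) exp_gt_zero b(2)])
  have "(\<lambda>n. d (r n)) \<longlonglongrightarrow> 0"
    using LIMSEQ_subseq_LIMSEQ[OF d(1) r] by (simp add: o_def)
  then have "OM_minimizer z"
    using z lim d x near
    by (intro near_maximizers_limit[of "\<lambda>n. d (r n)" "\<lambda>n. d (r n)" "\<lambda>n. x (r n)"]) (auto simp: cm_space_iff)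
  then show ?thesis by blast
qed

end

theorem theorem2p5:
  fixes p :: real
    and \<sigma> :: "nat \<Rightarrow> real"
    and \<Phi> :: "(nat \<Rightarrow> real) \<Rightarrow> real"
    and \<mu> \<mu>y :: "(nat \<Rightarrow> real) measure"
  assumes "1 \<le> p"
    and "\<And>k. \<sigma> k > 0"
    and "AE u in gauss_seq \<sigma>. u \<in> lp p"
    and "admissible_potential p \<Phi>"
    and "\<mu> = gauss_lp p \<sigma>"
    and "\<mu>y = posterior \<mu> \<Phi>"
  shows
    "(\<forall>z\<in>lp p.
        ((\<exists>\<zeta>. asymptotic_maximizing_family p \<mu>y \<zeta> \<and> strong_limit_point p \<zeta> z) \<longleftrightarrow>
         (z \<in> cm_space p \<mu> \<and>
          (\<forall>u\<in>cm_space p \<mu>. onsager_machlup p \<mu> \<Phi> z \<le> onsager_machlup p \<mu> \<Phi> u))) \<and>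
        ((z \<in> cm_space p \<mu> \<and>
          (\<forall>u\<in>cm_space p \<mu>. onsager_machlup p \<mu> \<Phi> z \<le> onsager_machlup p \<mu> \<Phi> u)) \<longleftrightarrow>
         MAP_estimator p \<mu>y z)) \<and>
     (\<exists>z. MAP_estimator p \<mu>y z)"
proof -
  interpret gaussian_posterior p \<sigma> \<Phi>
    by unfold_locales (use assms in auto)
  show ?thesis
    unfolding assms(5,6)
    using minimizer_if_limit_point MAP_estimator_if_minimizer limit_point_if_MAP_estimator minimizer_exists
    by blast
qed

end
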